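(* Let $\Sigma\subset \Lambda_3\times\Lambda_1\times\Lambda_2\times\Lambda_4\times\Lambda_5\cong(\mathbb{P}^1)^5$, $\Lambda_3\times\Lambda_1\times\Lambda_2\times\Lambda_4\times\Lambda_5\subset(\mathbb{P}^2)^5$, with coordinates $(v_1:v_2:v_3),(w_1:w_2:w_3),(z_1:z_2:z_3),(t_1:t_2:t_3),(s_1:s_2:s_3)$ on the successive factors, be the image of the del Pezzo surface $Y$ of degree $5$ under the map $\varphi_3\times\varphi_1\times\varphi_2\times\varphi_4\times\varphi_5$. Then $\Sigma$ is defined in $\Lambda_3\times\Lambda_1\times\Lambda_2\times\Lambda_4\times\Lambda_5$ by the following ten equations: \begin{align*} 1)\ & v_1w_1z_1-v_2w_2z_2=0, & 2)\ & v_3w_1t_1-v_2w_3t_3=0,\\ 3)\ & v_1z_3t_3+v_3z_2t_2=0, & 4)\ & w_3z_1t_2+w_2z_3t_1=0,\\ 5)\ & t_1v_1s_2-t_2v_2s_1=0, & 6)\ & t_1z_2s_3-t_3z_1s_1=0,\\ 7)\ & t_3w_2s_2-t_2w_1s_3=0, & 8)\ & v_3w_2s_1-v_1w_3s_3=0,\\ 9)\ & v_2z_3s_3+v_3z_1s_2=0, & 10)\ & w_3z_2s_2+w_1z_3s_1=0. \end{align*}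
   Context: Work over $\mathbb{C}$. $Y$ is the blow-up of $\mathbb{P}^2$ (coordinates $x_1,x_2,x_3$) at $p_1=(1:0:0)$, $p_2=(0:1:0)$, $p_3=(0:0:1)$, $p_4=(1:1:1)$. For $1\le i\le4$, $\varphi_i:Y\to\mathbb{P}^1$ is the morphism induced by projection from $p_i$, and $\varphi_5:Y\to\mathbb{P}^1$ is the morphism induced by the pencil of conics through $p_1,\dots,p_4$. Put $y_1=x_3-x_2$, $y_2=x_1-x_3$, $y_3=x_2-x_1$, so that $y_1+y_2+y_3=0$ and $x_1y_1+x_2y_2+x_3y_3=0$. The targets of the $\varphi_i$ are realized as the lines in $\mathbb{P}^2$ $$\Lambda_1=\{w_1-w_2+w_3=0\},\ \Lambda_2=\{z_1-z_2+z_3=0\},\ \Lambda_3=\{v_1-v_2+v_3=0\},$$ $$\Lambda_4=\{t_1-t_2+t_3=0\},\ \Lambda_5=\{s_1-s_2+s_3=0\},$$ and the map $\varphi_3\times\varphi_1\times\varphi_2\times\varphi_4\times\varphi_5:Y\to\Lambda_3\times\Lambda_1\times\Lambda_2\times\Lambda_4\times\Lambda_5$ is the morphism given, on the open set where these expressions define points of the respective lines, by $$(v_1:v_2:v_3)=(x_1:x_2:y_3),\quad (w_1:w_2:w_3)=(x_2:x_3:y_1),\quad (z_1:z_2:z_3)=(x_3:x_1:y_2),$$ $$(t_1:t_2:t_3)=(y_1:-y_2:y_3),\quad (s_1:s_2:s_3)=(x_1y_1:-x_2y_2:x_3y_3).$$ *)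

theory Defs
  imports "HOL-Analysis.Analysis"
begin

section \<open>The complex projective plane\<close>

definition proj_rel :: "complex^3 \<Rightarrow> complex^3 \<Rightarrow> bool" where
  "proj_rel x y \<longleftrightarrow> x \<noteq> 0 \<and> y \<noteq> 0 \<and> (\<exists>c. y = c *s x)"

lemma part_equivp_proj_rel: "part_equivp proj_rel"
proof (rule part_equivpI)
  show "\<exists>x. proj_rel x x"
    by (rule exI[of _ "axis 1 1"])
       (auto simp: proj_rel_def axis_eq_0_iff intro!: exI[of _ 1])
  show "symp proj_rel"
  proof (rule sympI)
    fix x y assume "proj_rel x y"
    then obtain c where c: "x \<noteq> 0" "y \<noteq> 0" "y = c *s x"
      by (auto simp: proj_rel_def)
    hence "c \<noteq> 0" by auto
    hence "x = inverse c *s y" using c(3) by (simp add: vector_smult_assoc)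
    thus "proj_rel y x" using c unfolding proj_rel_def by blast
  qed
  show "transp proj_rel"
    by (rule transpI) (auto simp: proj_rel_def vector_smult_assoc)
qed

text \<open>\<open>hc x\<close> is the point with homogeneous coordinates \<open>x\<close>; it is meaningful only for
  \<open>x \<noteq> 0\<close>.\<close>

quotient_type p2 = "complex^3" / partial: proj_rel
  morphisms rep_p2 hc
  by (rule part_equivp_proj_rel)

lemma hc_eq_iff:
  assumes "x \<noteq> 0" "y \<noteq> 0"
  shows "hc x = hc y \<longleftrightarrow> (\<exists>c. y = c *s x)"
proof -
  have r: "proj_rel u u" if "u \<noteq> 0" for u
    using that by (auto simp: proj_rel_def intro!: exI[of _ 1])
  show ?thesis
    using Quotient3_rel[OF Quotient3_p2, of x y] r[OF assms(1)] r[OF assms(2)] assms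
    by (auto simp: proj_rel_def)
qed

lemma hc_surj: "\<exists>x. x \<noteq> 0 \<and> P = hc x"
  using Quotient3_abs_rep[OF Quotient3_p2, of P] Quotient3_rep_reflp[OF Quotient3_p2, of P]
  by (metis proj_rel_def)

section \<open>Subvarieties of products of projective planes\<close>

text \<open>A point of \<open>(\<P>\<^sup>2)\<^sup>I\<close> is a function \<open>'i \<Rightarrow> p2\<close>; \<open>hcoords a P\<close> says that the tuple \<open>a\<close> of
  vectors is a tuple of homogeneous coordinates of \<open>P\<close>.\<close>

definition hcoords :: "('i \<Rightarrow> complex^3) \<Rightarrow> ('i \<Rightarrow> p2) \<Rightarrow> bool" where
  "hcoords a P \<longleftrightarrow> (\<forall>i. a i \<noteq> 0 \<and> P i = hc (a i))"

text \<open>Polynomials in the coordinates, represented by the functions they define; this loses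
  nothing because \<open>\<complex>\<close> is infinite.\<close>

inductive poly_fun :: "(('i \<Rightarrow> complex^3) \<Rightarrow> complex) \<Rightarrow> bool" where
  const: "poly_fun (\<lambda>a. c)"
| coord: "poly_fun (\<lambda>a. a i $ k)"
| add: "poly_fun f \<Longrightarrow> poly_fun g \<Longrightarrow> poly_fun (\<lambda>a. f a + g a)"
| mult: "poly_fun f \<Longrightarrow> poly_fun g \<Longrightarrow> poly_fun (\<lambda>a. f a * g a)"

definition multihom :: "('i::finite \<Rightarrow> nat) \<Rightarrow> (('i \<Rightarrow> complex^3) \<Rightarrow> complex) \<Rightarrow> bool" where
  "multihom d f \<longleftrightarrow> poly_fun f \<and>
     (\<forall>c a. f (\<lambda>i. c i *s a i) = (\<Prod>i\<in>UNIV. c i ^ d i) * f a)"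

definition vanishes_at :: "(('i \<Rightarrow> complex^3) \<Rightarrow> complex) \<Rightarrow> ('i \<Rightarrow> p2) \<Rightarrow> bool" where
  "vanishes_at f P \<longleftrightarrow> (\<forall>a. hcoords a P \<longrightarrow> f a = 0)"

text \<open>A map to \<open>\<P>\<^sup>2\<close> is regular if locally it is given by a triple of multihomogeneous
  polynomials of equal multidegree. The open neighbourhood of \<open>P\<close> on which the
  representation holds is the non-vanishing locus of the triple: any smaller neighbourhood
  contains one of this form, since the triple may be multiplied by a multihomogeneous
  polynomial that is nonzero at \<open>P\<close>.\<close>

definition regular_on :: "('i::finite \<Rightarrow> p2) set \<Rightarrow> (('i \<Rightarrow> p2) \<Rightarrow> p2) \<Rightarrow> bool" where
  "regular_on X \<phi> \<longleftrightarrow> (\<forall>P\<in>X. \<exists>d F.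
     (\<forall>k::3. multihom d (F k)) \<and>
     (\<exists>k. \<not> vanishes_at (F k) P) \<and>
     (\<forall>Q\<in>X. \<forall>b. hcoords b Q \<and> (\<chi> k. F k b) \<noteq> 0 \<longrightarrow> \<phi> Q = hc (\<chi> k. F k b)))"

definition morphism_between ::
  "('i::finite \<Rightarrow> p2) set \<Rightarrow> ('j \<Rightarrow> p2) set \<Rightarrow> (('i \<Rightarrow> p2) \<Rightarrow> ('j \<Rightarrow> p2)) \<Rightarrow> bool" where
  "morphism_between X B \<Phi> \<longleftrightarrow> \<Phi> \<in> X \<rightarrow> B \<and> (\<forall>j. regular_on X (\<lambda>P. \<Phi> P j))"

text \<open>\<open>X\<close> is defined in \<open>B\<close> by the equations \<open>es\<close>, scheme-theoretically: it is their common
  zero locus in \<open>B\<close>, and at every point \<open>P\<close> of \<open>B\<close> the stalk of the ideal sheaf of \<open>X\<close> in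
  \<open>B\<close> is generated by \<open>es\<close>. The latter says that a multihomogeneous \<open>f\<close> vanishing on \<open>X\<close>
  becomes, after multiplication by some \<open>g\<close> with \<open>g(P) \<noteq> 0\<close> (i.e. up to a unit of the local
  ring at \<open>P\<close>), a combination of \<open>es\<close> with polynomial coefficients as a function on \<open>B\<close>.\<close>

definition defined_in_by ::
  "('i::finite \<Rightarrow> p2) set \<Rightarrow> (('i \<Rightarrow> complex^3) \<Rightarrow> complex) list \<Rightarrow> ('i \<Rightarrow> p2) set \<Rightarrow> bool" where
  "defined_in_by B es X \<longleftrightarrow>
     X = {P \<in> B. \<forall>e\<in>set es. vanishes_at e P} \<and>
     (\<forall>P\<in>B. \<forall>d f. multihom d f \<and> (\<forall>Q\<in>X. vanishes_at f Q) \<longrightarrow>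
        (\<exists>d' g h. multihom d' g \<and> \<not> vanishes_at g P \<and> (\<forall>k<length es. poly_fun (h k)) \<and>
           (\<forall>Q\<in>B. \<forall>a. hcoords a Q \<longrightarrow> g a * f a = (\<Sum>k<length es. h k a * (es ! k) a))))"

section \<open>The del Pezzo surface of degree 5\<close>

text \<open>The blow-up of \<open>\<P>\<^sup>2\<close> at a point \<open>p\<close> is the variety of pairs \<open>(x, l)\<close> where \<open>l\<close> is a line
  through \<open>p\<close> and \<open>x\<close>; the blow-up at several distinct points is the fibre product of these
  over \<open>\<P>\<^sup>2\<close>. Lines are points of the dual plane: \<open>l\<close> stands for \<open>l\<^sub>1x\<^sub>1 + l\<^sub>2x\<^sub>2 + l\<^sub>3x\<^sub>3 = 0\<close>.\<close>

datatype bl = Pt | L1 | L2 | L3 | L4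

instance bl :: finite
proof
  have "(UNIV :: bl set) = {Pt, L1, L2, L3, L4}" using bl.exhaust by auto
  thus "finite (UNIV :: bl set)" by (metis finite.emptyI finite_insert)
qed

definition incident :: "complex^3 \<Rightarrow> complex^3 \<Rightarrow> bool" where
  "incident x l \<longleftrightarrow> (\<Sum>k\<in>UNIV. l $ k * x $ k) = 0"

definition del_pezzo :: "(bl \<Rightarrow> p2) set" where
  "del_pezzo = {P. \<forall>a. hcoords a P \<longrightarrow>
     (\<forall>(i, p) \<in> {(L1, vector [1, 0, 0]), (L2, vector [0, 1, 0]),
                  (L3, vector [0, 0, 1]), (L4, vector [1, 1, 1])}.
        incident p (a i) \<and> incident (a Pt) (a i))}"

section \<open>The five fibrations\<close>

text \<open>The constructors index the factors
  \<open>\<Lambda>\<^sub>3 \<times> \<Lambda>\<^sub>1 \<times> \<Lambda>\<^sub>2 \<times> \<Lambda>\<^sub>4 \<times> \<Lambda>\<^sub>5\<close>, with coordinates \<open>v\<close>, \<open>w\<close>, \<open>z\<close>, \<open>t\<close>, \<open>s\<close>, in this order.\<close>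

datatype factor = V | W | Z | T | S

instance factor :: finite
proof
  have "(UNIV :: factor set) = {V, W, Z, T, S}" using factor.exhaust by auto
  thus "finite (UNIV :: factor set)" by (metis finite.emptyI finite_insert)
qed

definition Lambda_prod :: "(factor \<Rightarrow> p2) set" where
  "Lambda_prod = {P. \<forall>a. hcoords a P \<longrightarrow> (\<forall>j. a j $ 1 - a j $ 2 + a j $ 3 = 0)}"

definition phi_formula :: "complex^3 \<Rightarrow> factor \<Rightarrow> complex^3" where
  "phi_formula x j =
    (let x1 = x $ 1; x2 = x $ 2; x3 = x $ 3;
         y1 = x3 - x2; y2 = x1 - x3; y3 = x2 - x1
     in case j of
          V \<Rightarrow> vector [x1, x2, y3]
        | W \<Rightarrow> vector [x2, x3, y1]
        | Z \<Rightarrow> vector [x3, x1, y2]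
        | T \<Rightarrow> vector [y1, - y2, y3]
        | S \<Rightarrow> vector [x1 * y1, - (x2 * y2), x3 * y3])"

text \<open>The morphism given by these formulas on the open set where all five of them define points;
  it exists (\<open>phi_morphism_exists\<close> below), and is unique because that set is dense in the
  irreducible surface.\<close>

definition is_phi_morphism :: "((bl \<Rightarrow> p2) \<Rightarrow> (factor \<Rightarrow> p2)) \<Rightarrow> bool" where
  "is_phi_morphism \<Phi> \<longleftrightarrow>
     morphism_between del_pezzo Lambda_prod \<Phi> \<and>
     (\<forall>P\<in>del_pezzo. \<forall>x. x \<noteq> 0 \<and> P Pt = hc x \<and> (\<forall>j. phi_formula x j \<noteq> 0) \<longrightarrow>
        (\<forall>j. \<Phi> P j = hc (phi_formula x j)))"

section \<open>Existence of the morphism\<close>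

lemma hc_eqI:
  assumes "u \<noteq> 0" "v \<noteq> 0" "u$1 * v$2 = u$2 * v$1" "u$1 * v$3 = u$3 * v$1" "u$2 * v$3 = u$3 * v$2"
  shows "hc u = hc v"
proof -
  have "\<exists>c. v = c *s u"
  proof (cases "u$1 = 0")
    case False
    thus ?thesis using assms
      by (intro exI[of _ "v$1/u$1"]) (auto simp: vec_eq_iff forall_3 field_simps)
  next
    case True
    show ?thesis
    proof (cases "u$2 = 0")
      case False
      thus ?thesis using assms True
        by (intro exI[of _ "v$2/u$2"]) (auto simp: vec_eq_iff forall_3 field_simps)
    next
      case T2: True
      hence "u$3 \<noteq> 0" using assms True by (auto simp: vec_eq_iff forall_3)
      thus ?thesis using assms True T2
        by (intro exI[of _ "v$3/u$3"]) (auto simp: vec_eq_iff forall_3 field_simps)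
    qed
  qed
  thus ?thesis using hc_eq_iff assms by blast
qed

lemma hc_eqD:
  assumes "u \<noteq> 0" "v \<noteq> 0" "hc u = hc v"
  shows "\<exists>c. c \<noteq> 0 \<and> v = c *s u"
  using assms by (metis hc_eq_iff vector_mul_eq_0)

definition fib_lin :: "(bl \<Rightarrow> complex^3) \<Rightarrow> factor \<Rightarrow> complex^3" where
  "fib_lin a j = (case j of
     V \<Rightarrow> vector [a L3 $ 2, - a L3 $ 1, - a L3 $ 1 - a L3 $ 2]
   | W \<Rightarrow> vector [a L1 $ 3, - a L1 $ 2, - a L1 $ 2 - a L1 $ 3]
   | Z \<Rightarrow> vector [a L2 $ 1, - a L2 $ 3, - a L2 $ 3 - a L2 $ 1]
   | T \<Rightarrow> vector [a L4 $ 1, - a L4 $ 2, a L4 $ 3]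
   | S \<Rightarrow> 0)"

text \<open>On the surface, \<open>\<phi>\<^sub>1, \<dots>, \<phi>\<^sub>4\<close> are linear in the coordinates of the four lines (\<open>fib_lin\<close>). The point
  \<open>\<phi>\<^sub>5\<close> is read off from one of the
  relations \<open>t\<^sub>1v\<^sub>1s\<^sub>2 = t\<^sub>2v\<^sub>2s\<^sub>1\<close>, \<open>t\<^sub>1z\<^sub>2s\<^sub>3 = t\<^sub>3z\<^sub>1s\<^sub>1\<close>, \<open>t\<^sub>3w\<^sub>2s\<^sub>2 = t\<^sub>2w\<^sub>1s\<^sub>3\<close>, each of which determines \<open>s\<close>
  wherever the resulting triple is nonzero.\<close>

definition fib_chart :: "nat \<Rightarrow> (factor \<Rightarrow> complex^3) \<Rightarrow> complex^3" where
  "fib_chart n b = (if n = 0 then vector [b T$1*b V$1, b T$2*b V$2, b T$2*b V$2 - b T$1*b V$1]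
     else if n = 1 then vector [b T$1*b Z$2, b T$1*b Z$2 + b T$3*b Z$1, b T$3*b Z$1]
     else vector [b T$2*b W$1 - b T$3*b W$2, b T$2*b W$1, b T$3*b W$2])"

definition fib_val :: "(bl \<Rightarrow> complex^3) \<Rightarrow> factor \<Rightarrow> complex^3" where
  "fib_val a j = (if j = S then fib_chart (LEAST n. fib_chart n (fib_lin a) \<noteq> 0) (fib_lin a) else fib_lin a j)"

definition fib_phi :: "(bl \<Rightarrow> p2) \<Rightarrow> factor \<Rightarrow> p2" where
  "fib_phi P j = hc (fib_val (SOME a. hcoords a P) j)"

definition bl_coords :: "(bl \<Rightarrow> complex^3) \<Rightarrow> bool" where
  "bl_coords a \<longleftrightarrow> (\<forall>i. a i \<noteq> 0) \<and> a L1 $ 1 = 0 \<and> a L2 $ 2 = 0 \<and> a L3 $ 3 = 0 \<and>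
      a L4 $ 1 + a L4 $ 2 + a L4 $ 3 = 0 \<and>
      a L1 $ 2 * a Pt $ 2 + a L1 $ 3 * a Pt $ 3 = 0 \<and>
      a L2 $ 1 * a Pt $ 1 + a L2 $ 3 * a Pt $ 3 = 0 \<and>
      a L3 $ 1 * a Pt $ 1 + a L3 $ 2 * a Pt $ 2 = 0 \<and>
      a L4 $ 1 * a Pt $ 1 + a L4 $ 2 * a Pt $ 2 + a L4 $ 3 * a Pt $ 3 = 0"

lemma incI: assumes "P \<in> del_pezzo" "hcoords a P" shows "bl_coords a"
  using assms unfolding del_pezzo_def bl_coords_def
  apply (auto simp: hcoords_def incident_def sum_3 vector_3 eval_nat_numeral)
  done

lemma nz3: "(v::complex^3) \<noteq> 0 \<longleftrightarrow> v$1 \<noteq> 0 \<or> v$2 \<noteq> 0 \<or> v$3 \<noteq> 0"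
  by (auto simp: vec_eq_iff forall_3)

lemma lin_nz: assumes "bl_coords a" "j \<noteq> S" shows "fib_lin a j \<noteq> 0"
  using assms by (cases j) (auto simp: fib_lin_def nz3 vector_3 bl_coords_def)

lemma lin_line: assumes "bl_coords a" shows "fib_lin a j $ 1 - fib_lin a j $ 2 + fib_lin a j $ 3 = 0"
  using assms by (cases j) (auto simp: fib_lin_def vector_3 bl_coords_def)

lemma rels:
  assumes "bl_coords a"
  defines "b \<equiv> fib_lin a"
  shows "b V$3 * b W$1 * b T$1 = b V$2 * b W$3 * b T$3"
    "b V$1 * b Z$3 * b T$3 + b V$3 * b Z$2 * b T$2 = 0"
    "b W$3 * b Z$1 * b T$2 + b W$2 * b Z$3 * b T$1 = 0"
proof -
  have x: "a Pt $ 1 \<noteq> 0 \<or> a Pt $ 2 \<noteq> 0 \<or> a Pt $ 3 \<noteq> 0"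
    using assms nz3 unfolding bl_coords_def by blast
  define x1 x2 x3 where "x1 = a Pt $ 1" "x2 = a Pt $ 2" "x3 = a Pt $ 3"
  define m2 m3 where "m2 = a L1 $ 2" "m3 = a L1 $ 3"
  define k1 k3 where "k1 = a L2 $ 1" "k3 = a L2 $ 3"
  define l1 l2 where "l1 = a L3 $ 1" "l2 = a L3 $ 2"
  define n1 n2 n3 where "n1 = a L4 $ 1" "n2 = a L4 $ 2" "n3 = a L4 $ 3"
  note d = x1_x2_x3_def m2_m3_def k1_k3_def l1_l2_def n1_n2_n3_def
  have e: "n1 + n2 + n3 = 0" "m2*x2+m3*x3 = 0" "k1*x1+k3*x3=0" "l1*x1+l2*x2=0" "n1*x1+n2*x2+n3*x3=0"
    using assms unfolding bl_coords_def d by auto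
  have x': "x1 \<noteq> 0 \<or> x2 \<noteq> 0 \<or> x3 \<noteq> 0" using x by (simp add: d)
  have n2: "n2 = - n1 - n3" using e(1) by algebra
  let ?A = "(-l1-l2)*m3*n1 - (-l1)*(-m2-m3)*n3"
  have "?A * x1 = 0" "?A * x2 = 0" "?A * x3 = 0" using e by algebra+
  hence A: "?A = 0" using x' by auto
  let ?B = "l2*(-k3-k1)*n3 + (-l1-l2)*(-k3)*(-n2)"
  have "?B * x1 = 0" "?B * x2 = 0" "?B * x3 = 0" using e by algebra+
  hence B: "?B = 0" using x' by auto
  let ?C = "(-m2-m3)*k1*(-n2) + (-m2)*(-k3-k1)*n1"
  have "?C * x1 = 0" "?C * x2 = 0" "?C * x3 = 0" using e by algebra+
  hence C: "?C = 0" using x' by auto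
  show "b V$3 * b W$1 * b T$1 = b V$2 * b W$3 * b T$3"
    using A by (simp add: b_def fib_lin_def vector_3 d) (simp add: algebra_simps)
  show "b V$1 * b Z$3 * b T$3 + b V$3 * b Z$2 * b T$2 = 0"
    using B by (simp add: b_def fib_lin_def vector_3 d)
  show "b W$3 * b Z$1 * b T$2 + b W$2 * b Z$3 * b T$1 = 0"
    using C by (simp add: b_def fib_lin_def vector_3 d)
qed


definition fib_idx :: "factor \<Rightarrow> bl" where
  "fib_idx j = (case j of V \<Rightarrow> L3 | W \<Rightarrow> L1 | Z \<Rightarrow> L2 | T \<Rightarrow> L4 | S \<Rightarrow> Pt)"

lemma lin_scale: "fib_lin (\<lambda>i. c i *s a i) j = c (fib_idx j) *s fib_lin a j"
  by (cases j) (auto simp: fib_lin_def fib_idx_def vec_eq_iff forall_3 vector_3 algebra_simps)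

lemma chart_scale: "\<exists>d. (\<forall>j. c j \<noteq> 0) \<longrightarrow> d \<noteq> 0 \<and> fib_chart n (\<lambda>j. c j *s b j) = d *s fib_chart n b"
proof -
  define d where "d = c T * (if n = 0 then c V else if n = 1 then c Z else c W)"
  have "(\<forall>j. c j \<noteq> 0) \<longrightarrow> d \<noteq> 0 \<and> fib_chart n (\<lambda>j. c j *s b j) = d *s fib_chart n b"
    by (auto simp: d_def fib_chart_def vec_eq_iff forall_3 vector_3 algebra_simps)
  thus ?thesis by blast
qed

locale fib_coords = fixes b :: "factor \<Rightarrow> complex^3"
  assumes nz: "\<And>j. j \<noteq> S \<Longrightarrow> b j \<noteq> 0"
    and line: "\<And>j. b j $ 1 - b j $ 2 + b j $ 3 = 0"
    and r2: "b V$3 * b W$1 * b T$1 = b V$2 * b W$3 * b T$3"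
    and r3: "b V$1 * b Z$3 * b T$3 + b V$3 * b Z$2 * b T$2 = 0"
    and r4: "b W$3 * b Z$1 * b T$2 + b W$2 * b Z$3 * b T$1 = 0"
begin

lemma third: "b j $ 3 = b j $ 2 - b j $ 1" using line[of j] by algebra

lemma nz2: "j \<noteq> S \<Longrightarrow> b j $ 1 \<noteq> 0 \<or> b j $ 2 \<noteq> 0"
  using nz[of j] third[of j] by (auto simp: nz3)

lemma chart_ex: "\<exists>n. fib_chart n b \<noteq> 0"
proof (rule ccontr)
  assume "\<nexists>n. fib_chart n b \<noteq> 0"
  hence c: "fib_chart 0 b = 0" "fib_chart 1 b = 0" "fib_chart 2 b = 0" by auto
  show False using c third[of T] nz2[of V] nz2[of W] nz2[of Z] nz2[of T]
    by (auto simp: fib_chart_def vec_eq_iff forall_3 vector_3)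
qed

lemma chart_line: "fib_chart n b $ 1 - fib_chart n b $ 2 + fib_chart n b $ 3 = 0"
  by (auto simp: fib_chart_def vector_3)

lemma c01: "fib_chart 0 b $ 1 * fib_chart 1 b $ 2 = fib_chart 0 b $ 2 * fib_chart 1 b $ 1"
proof -
  let ?A = "(b T$1*b V$1) * (b T$1*b Z$2 + b T$3*b Z$1) - (b T$2*b V$2) * (b T$1*b Z$2)"
  have "?A = 0" using r3 third[of T] third[of V] third[of Z] by algebra
  thus ?thesis by (simp add: fib_chart_def vector_3)
qed

lemma c02: "fib_chart 0 b $ 1 * fib_chart 2 b $ 2 = fib_chart 0 b $ 2 * fib_chart 2 b $ 1"
proof -
  let ?A = "(b T$1*b V$1) * (b T$2*b W$1) - (b T$2*b V$2) * (b T$2*b W$1 - b T$3*b W$2)"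
  have "?A = 0" using r2 third[of T] third[of V] third[of W] by algebra
  thus ?thesis by (simp add: fib_chart_def vector_3)
qed

lemma c12: "fib_chart 1 b $ 1 * fib_chart 2 b $ 2 = fib_chart 1 b $ 2 * fib_chart 2 b $ 1"
proof -
  let ?A = "(b T$1*b Z$2) * (b T$2*b W$1) - (b T$1*b Z$2 + b T$3*b Z$1) * (b T$2*b W$1 - b T$3*b W$2)"
  have "?A = 0" using r4 third[of T] third[of W] third[of Z] by algebra
  thus ?thesis by (simp add: fib_chart_def vector_3)
qed

lemma chart_compat:
  assumes "fib_chart m b \<noteq> 0" "fib_chart n b \<noteq> 0" shows "hc (fib_chart m b) = hc (fib_chart n b)"
proof -
  have big: "fib_chart k b = fib_chart 2 b" if "k \<ge> 2" for k using that by (auto simp: fib_chart_def)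
  have s: "fib_chart m b $ 1 * fib_chart n b $ 2 = fib_chart m b $ 2 * fib_chart n b $ 1" for m n
  proof -
    have "m = 0 \<or> m = 1 \<or> m \<ge> 2" "n = 0 \<or> n = 1 \<or> n \<ge> 2" by arith+
    thus ?thesis using c01 c02 c12 big[of m] big[of n] by (elim disjE) (auto simp: mult.commute)
  qed
  have t: "fib_chart k b $ 3 = fib_chart k b $ 2 - fib_chart k b $ 1" for k using chart_line[of k] by algebra
  show ?thesis
    by (rule hc_eqI) (use assms s[of m n] in \<open>auto simp: t algebra_simps\<close>)
qed

end

lemma fib_coords_lin: "bl_coords a \<Longrightarrow> fib_coords (fib_lin a)"
  by (rule fib_coords.intro) (use lin_nz lin_line rels in auto)

lemma hcoords_ex: "\<exists>a. hcoords a P"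
  unfolding hcoords_def by (rule choice) (use hc_surj in blast)

lemma val_eq:
  assumes "bl_coords a" "bl_coords a'" "hcoords a P" "hcoords a' P"
  shows "hc (fib_val a j) = hc (fib_val a' j)" "fib_val a j \<noteq> 0"
proof -
  interpret A: fib_coords "fib_lin a" using assms fib_coords_lin by auto
  interpret A': fib_coords "fib_lin a'" using assms fib_coords_lin by auto
  have "\<forall>i. \<exists>c. c \<noteq> 0 \<and> a' i = c *s a i"
    using assms hc_eqD unfolding hcoords_def by metis
  then obtain c where c: "\<And>i. c i \<noteq> 0" "\<And>i. a' i = c i *s a i" by metis
  have l: "fib_lin a' j = c (fib_idx j) *s fib_lin a j" for j
  proof -
    have "a' = (\<lambda>i. c i *s a i)" by (rule ext) (rule c(2))
    thus ?thesis by (simp only: lin_scale)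
  qed
  have ch: "fib_chart (LEAST n. fib_chart n (fib_lin a) \<noteq> 0) (fib_lin a) \<noteq> 0"
    using A.chart_ex by (metis (mono_tags, lifting) LeastI_ex)
  have ch': "fib_chart (LEAST n. fib_chart n (fib_lin a') \<noteq> 0) (fib_lin a') \<noteq> 0"
    using A'.chart_ex by (metis (mono_tags, lifting) LeastI_ex)
  show nz: "fib_val a j \<noteq> 0" using ch A.nz by (auto simp: fib_val_def)
  show "hc (fib_val a j) = hc (fib_val a' j)"
  proof (cases "j = S")
    case False
    thus ?thesis using l[of j] c(1) A.nz[of j] A'.nz[of j] by (auto simp: fib_val_def hc_eq_iff)
  next
    case True
    define n where "n = (LEAST n. fib_chart n (fib_lin a) \<noteq> 0)"
    obtain d where d: "d \<noteq> 0" "fib_chart n (\<lambda>j. c (fib_idx j) *s fib_lin a j) = d *s fib_chart n (fib_lin a)"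
      using chart_scale[of "\<lambda>j. c (fib_idx j)" n "fib_lin a"] c(1) by blast
    have la: "fib_lin a' = (\<lambda>j. c (fib_idx j) *s fib_lin a j)" using l by auto
    have nn: "fib_chart n (fib_lin a) \<noteq> 0" using ch n_def by simp
    have n': "fib_chart n (fib_lin a') \<noteq> 0" using d nn la by auto
    have "hc (fib_chart n (fib_lin a)) = hc (fib_chart n (fib_lin a'))"
      using d nn n' la by (auto simp: hc_eq_iff)
    also have "\<dots> = hc (fib_val a' j)" using A'.chart_compat[OF n' ch'] True by (simp add: fib_val_def)
    finally show ?thesis using True by (simp add: fib_val_def n_def)
  qed
qed

lemma phi_val:
  assumes "P \<in> del_pezzo" "hcoords a P" shows "fib_phi P j = hc (fib_val a j)" "fib_val a j \<noteq> 0"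
proof -
  have h: "hcoords (SOME a. hcoords a P) P" using hcoords_ex by (metis someI)
  show "fib_phi P j = hc (fib_val a j)" "fib_val a j \<noteq> 0"
    unfolding fib_phi_def using val_eq[of _ _ P j] incI[OF assms(1)] h assms(2) by metis+
qed

lemma phi_chart:
  assumes "P \<in> del_pezzo" "hcoords a P" "fib_chart n (fib_lin a) \<noteq> 0"
  shows "fib_phi P S = hc (fib_chart n (fib_lin a))"
proof -
  interpret A: fib_coords "fib_lin a" by (rule fib_coords_lin[OF incI[OF assms(1,2)]])
  define m where "m = (LEAST n. fib_chart n (fib_lin a) \<noteq> 0)"
  have v: "fib_val a S = fib_chart m (fib_lin a)" by (simp add: fib_val_def m_def)
  have "fib_chart m (fib_lin a) \<noteq> 0" using phi_val(2)[OF assms(1,2), of S] unfolding v .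
  thus ?thesis using phi_val(1)[OF assms(1,2), of S] A.chart_compat[OF _ assms(3), of m] unfolding v by metis
qed

lemma phi_lin:
  assumes "P \<in> del_pezzo" "hcoords a P" "j \<noteq> S" shows "fib_phi P j = hc (fib_lin a j)"
  using phi_val[OF assms(1,2), of j] assms(3) by (simp add: fib_val_def)

lemma vec_scale_line: "u $ 1 - u $ 2 + u $ 3 = 0 \<Longrightarrow> (c *s (u::complex^3)) $ 1 - (c *s u) $ 2 + (c *s u) $ 3 = 0"
proof -
  assume "u $ 1 - u $ 2 + u $ 3 = 0"
  hence "c * (u $ 1 - u $ 2 + u $ 3) = 0" by simp
  thus ?thesis by (simp add: distrib_left right_diff_distrib)
qed

lemma phi_Lambda: assumes "P \<in> del_pezzo" shows "fib_phi P \<in> Lambda_prod"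
  unfolding Lambda_prod_def
proof (intro CollectI allI impI)
  fix b j assume b: "hcoords b (fib_phi P)"
  obtain a where a: "hcoords a P" using hcoords_ex by blast
  interpret A: fib_coords "fib_lin a" by (rule fib_coords_lin[OF incI[OF assms a]])
  have "hc (fib_val a j) = hc (b j)" using b phi_val[OF assms a] unfolding hcoords_def by metis
  moreover have "b j \<noteq> 0" using b by (simp add: hcoords_def)
  ultimately obtain c where c: "b j = c *s fib_val a j"
    using phi_val[OF assms a] hc_eq_iff by metis
  have "fib_val a j $ 1 - fib_val a j $ 2 + fib_val a j $ 3 = 0"
    using A.line A.chart_line by (simp add: fib_val_def)
  thus "b j $ 1 - b j $ 2 + b j $ 3 = 0" unfolding c by (rule vec_scale_line)
qed

lemma lin_formula:
  assumes "bl_coords a" "j \<noteq> S"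
  shows "fib_lin a j $ 1 * phi_formula (a Pt) j $ 2 = fib_lin a j $ 2 * phi_formula (a Pt) j $ 1"
    "fib_lin a j $ 1 * phi_formula (a Pt) j $ 3 = fib_lin a j $ 3 * phi_formula (a Pt) j $ 1"
    "fib_lin a j $ 2 * phi_formula (a Pt) j $ 3 = fib_lin a j $ 3 * phi_formula (a Pt) j $ 2"
proof -
  define x1 x2 x3 where "x1 = a Pt $ 1" "x2 = a Pt $ 2" "x3 = a Pt $ 3"
  define m2 m3 where "m2 = a L1 $ 2" "m3 = a L1 $ 3"
  define k1 k3 where "k1 = a L2 $ 1" "k3 = a L2 $ 3"
  define l1 l2 where "l1 = a L3 $ 1" "l2 = a L3 $ 2"
  define n1 n2 n3 where "n1 = a L4 $ 1" "n2 = a L4 $ 2" "n3 = a L4 $ 3"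
  note d = x1_x2_x3_def m2_m3_def k1_k3_def l1_l2_def n1_n2_n3_def
  have e: "n1 + n2 + n3 = 0" "m2*x2+m3*x3 = 0" "k1*x1+k3*x3=0" "l1*x1+l2*x2=0" "n1*x1+n2*x2+n3*x3=0"
    using assms unfolding bl_coords_def d by auto
  have L: "fib_lin a V = vector [l2, -l1, -l1-l2]" "fib_lin a W = vector [m3, -m2, -m2-m3]"
    "fib_lin a Z = vector [k1, -k3, -k3-k1]" "fib_lin a T = vector [n1, -n2, n3]"
    by (simp_all add: fib_lin_def d)
  have F: "phi_formula (a Pt) V = vector [x1, x2, x2-x1]" "phi_formula (a Pt) W = vector [x2, x3, x3-x2]"
    "phi_formula (a Pt) Z = vector [x3, x1, x1-x3]"
    "phi_formula (a Pt) T = vector [x3-x2, -(x1-x3), x2-x1]"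
    by (simp_all add: phi_formula_def Let_def d)
  have V: "fib_lin a V $ 1 * phi_formula (a Pt) V $ 2 = fib_lin a V $ 2 * phi_formula (a Pt) V $ 1"
    "fib_lin a V $ 1 * phi_formula (a Pt) V $ 3 = fib_lin a V $ 3 * phi_formula (a Pt) V $ 1"
    "fib_lin a V $ 2 * phi_formula (a Pt) V $ 3 = fib_lin a V $ 3 * phi_formula (a Pt) V $ 2"
    unfolding L F vector_3 using e by algebra+
  have W: "fib_lin a W $ 1 * phi_formula (a Pt) W $ 2 = fib_lin a W $ 2 * phi_formula (a Pt) W $ 1"
    "fib_lin a W $ 1 * phi_formula (a Pt) W $ 3 = fib_lin a W $ 3 * phi_formula (a Pt) W $ 1"
    "fib_lin a W $ 2 * phi_formula (a Pt) W $ 3 = fib_lin a W $ 3 * phi_formula (a Pt) W $ 2"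
    unfolding L F vector_3 using e by algebra+
  have Z: "fib_lin a Z $ 1 * phi_formula (a Pt) Z $ 2 = fib_lin a Z $ 2 * phi_formula (a Pt) Z $ 1"
    "fib_lin a Z $ 1 * phi_formula (a Pt) Z $ 3 = fib_lin a Z $ 3 * phi_formula (a Pt) Z $ 1"
    "fib_lin a Z $ 2 * phi_formula (a Pt) Z $ 3 = fib_lin a Z $ 3 * phi_formula (a Pt) Z $ 2"
    unfolding L F vector_3 using e by algebra+
  have T: "fib_lin a T $ 1 * phi_formula (a Pt) T $ 2 = fib_lin a T $ 2 * phi_formula (a Pt) T $ 1"
    "fib_lin a T $ 1 * phi_formula (a Pt) T $ 3 = fib_lin a T $ 3 * phi_formula (a Pt) T $ 1"
    "fib_lin a T $ 2 * phi_formula (a Pt) T $ 3 = fib_lin a T $ 3 * phi_formula (a Pt) T $ 2"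
    unfolding L F vector_3 using e by algebra+
  show "fib_lin a j $ 1 * phi_formula (a Pt) j $ 2 = fib_lin a j $ 2 * phi_formula (a Pt) j $ 1"
    "fib_lin a j $ 1 * phi_formula (a Pt) j $ 3 = fib_lin a j $ 3 * phi_formula (a Pt) j $ 1"
    "fib_lin a j $ 2 * phi_formula (a Pt) j $ 3 = fib_lin a j $ 3 * phi_formula (a Pt) j $ 2"
    using V W Z T assms(2) by (cases j; simp only: simp_thms)+
qed

lemma chart_formula:
  assumes "f = phi_formula x"
  shows "fib_chart n f $ 1 * f S $ 2 = fib_chart n f $ 2 * f S $ 1"
    "fib_chart n f $ 1 * f S $ 3 = fib_chart n f $ 3 * f S $ 1"
    "fib_chart n f $ 2 * f S $ 3 = fib_chart n f $ 3 * f S $ 2"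
proof -
  define x1 x2 x3 where "x1 = x $ 1" "x2 = x $ 2" "x3 = x $ 3"
  have F: "f V = vector [x1, x2, x2-x1]" "f W = vector [x2, x3, x3-x2]"
    "f Z = vector [x3, x1, x1-x3]" "f T = vector [x3-x2, -(x1-x3), x2-x1]"
    "f S = vector [x1*(x3-x2), -(x2*(x1-x3)), x3*(x2-x1)]"
    by (simp_all add: assms phi_formula_def Let_def x1_x2_x3_def)
  have c: "fib_chart n f = f S"
    by (simp add: fib_chart_def F vec_eq_iff forall_3 vector_3 algebra_simps)
  show "fib_chart n f $ 1 * f S $ 2 = fib_chart n f $ 2 * f S $ 1"
    "fib_chart n f $ 1 * f S $ 3 = fib_chart n f $ 3 * f S $ 1"
    "fib_chart n f $ 2 * f S $ 3 = fib_chart n f $ 3 * f S $ 2"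
    by (simp_all add: c)
qed

lemma phi_formula_agrees:
  assumes "P \<in> del_pezzo" "x \<noteq> 0" "P Pt = hc x" "\<forall>j. phi_formula x j \<noteq> 0"
  shows "fib_phi P j = hc (phi_formula x j)"
proof -
  obtain a0 where a0: "hcoords a0 P" using hcoords_ex by blast
  define a where "a = a0(Pt := x)"
  have a: "hcoords a P" using a0 assms by (auto simp: a_def hcoords_def)
  have x: "a Pt = x" by (simp add: a_def)
  have i: "bl_coords a" by (rule incI[OF assms(1) a])
  interpret A: fib_coords "fib_lin a" by (rule fib_coords_lin[OF i])
  have e: "hc (phi_formula x j) = hc (fib_lin a j)" if "j \<noteq> S" for j
    using hc_eqI[OF A.nz[OF that], of "phi_formula x j"] lin_formula[OF i that] assms(4) x by simp
  show ?thesis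
  proof (cases "j = S")
    case False thus ?thesis using e phi_lin[OF assms(1) a] by simp
  next
    case True
    have "\<forall>j. \<exists>c. c \<noteq> 0 \<and> (j \<noteq> S \<longrightarrow> fib_lin a j = c *s phi_formula x j)"
      using hc_eqD e A.nz assms(4) zero_neq_one by metis
    then obtain c where c: "\<And>j. c j \<noteq> 0" "\<And>j. j \<noteq> S \<Longrightarrow> fib_lin a j = c j *s phi_formula x j" by metis
    obtain n where n: "fib_chart n (fib_lin a) \<noteq> 0" using A.chart_ex by blast
    have "fib_chart n (fib_lin a) = fib_chart n (\<lambda>j. c j *s phi_formula x j)"
      using c(2) by (simp add: fib_chart_def)
    then obtain d where d: "d \<noteq> 0" "fib_chart n (fib_lin a) = d *s fib_chart n (phi_formula x)"
      using chart_scale[of c n "phi_formula x"] c(1) by auto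
    have n': "fib_chart n (phi_formula x) \<noteq> 0" using d n by auto
    have "hc (fib_chart n (phi_formula x)) = hc (phi_formula x S)"
      by (rule hc_eqI[OF n']) (use assms(4) chart_formula in auto)
    moreover have "hc (fib_chart n (phi_formula x)) = hc (fib_chart n (fib_lin a))"
      using d n n' by (auto simp: hc_eq_iff)
    ultimately show ?thesis using True phi_chart[OF assms(1) a n] by simp
  qed
qed

lemma mh_coord: "multihom (\<lambda>i. if i = l then 1 else 0) (\<lambda>a. a l $ k)"
proof -
  have "(\<Prod>i\<in>UNIV. c i ^ (if i = l then 1 else 0)) = (c l :: complex)" for c :: "'a \<Rightarrow> complex"
  proof -
    have "(\<Prod>i\<in>UNIV. c i ^ (if i = l then 1 else 0)) = (\<Prod>i\<in>UNIV. if i = l then c i else 1)"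
      by (rule prod.cong) simp_all
    thus ?thesis by simp
  qed
  thus ?thesis by (simp add: multihom_def poly_fun.coord)
qed

lemma mh_add: "multihom d f \<Longrightarrow> multihom d g \<Longrightarrow> multihom d (\<lambda>a. f a + g a)"
  unfolding multihom_def by (intro conjI poly_fun.add) (simp_all add: distrib_left)

lemma mh_cmult: "multihom d f \<Longrightarrow> multihom d (\<lambda>a. c * f a)"
  unfolding multihom_def by (intro conjI poly_fun.mult poly_fun.const) simp_all

lemma mh_minus: "multihom d f \<Longrightarrow> multihom d (\<lambda>a. - f a)"
  using mh_cmult[of d f "-1"] by simp

lemma mh_diff: "multihom d f \<Longrightarrow> multihom d g \<Longrightarrow> multihom d (\<lambda>a. f a - g a)"
  using mh_add[OF _ mh_minus, of d f g] by simp

lemma mh_mult: "multihom d f \<Longrightarrow> multihom e g \<Longrightarrow> multihom (\<lambda>i. d i + e i) (\<lambda>a. f a * g a)"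
  unfolding multihom_def by (intro conjI poly_fun.mult) (simp_all add: power_add prod.distrib)

lemma mh_lin: assumes "j \<noteq> S" shows "multihom (\<lambda>i. if i = fib_idx j then 1 else 0) (\<lambda>a. fib_lin a j $ k)"
proof -
  have "k = 1 \<or> k = 2 \<or> k = 3" using exhaust_3 by blast
  thus ?thesis using assms
    by (cases j; elim disjE) (auto simp: fib_lin_def fib_idx_def vector_3 intro!: mh_diff mh_minus mh_coord)
qed

lemma mh_chart: "\<exists>d. \<forall>k. multihom d (\<lambda>a. fib_chart n (fib_lin a) $ k)"
proof -
  define j where "j = (if n = 0 then V else if n = 1 then Z else W)"
  have j: "j \<noteq> S" by (auto simp: j_def)
  have m: "multihom (\<lambda>i. (if i = fib_idx T then 1 else 0) + (if i = fib_idx j then 1 else 0))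
     (\<lambda>a. fib_lin a T $ k * fib_lin a j $ l)" for k l
    by (intro mh_mult mh_lin j) simp
  have "multihom (\<lambda>i. (if i = fib_idx T then 1 else 0) + (if i = fib_idx j then 1 else 0))
     (\<lambda>a. fib_chart n (fib_lin a) $ k)" for k
  proof -
    have "k = 1 \<or> k = 2 \<or> k = 3" using exhaust_3 by blast
    thus ?thesis
      using m by (cases "n = 0"; cases "n = 1"; elim disjE)
        (auto simp: fib_chart_def vector_3 j_def intro!: mh_diff mh_add)
  qed
  thus ?thesis by blast
qed

lemma regularI:
  assumes "\<And>P. P \<in> X \<Longrightarrow> \<exists>d G a. (\<forall>k. multihom d (\<lambda>a. G a $ k)) \<and> hcoords a P \<and> G a \<noteq> 0 \<and>
     (\<forall>Q\<in>X. \<forall>b. hcoords b Q \<longrightarrow> G b \<noteq> 0 \<longrightarrow> \<phi> Q = hc (G b))"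
  shows "regular_on X \<phi>"
  unfolding regular_on_def
proof
  fix P assume "P \<in> X"
  from assms[OF this] obtain d and G :: "_ \<Rightarrow> complex^3" and a where
    G: "\<forall>k. multihom d (\<lambda>a. G a $ k)" "hcoords a P" "G a \<noteq> 0"
      "\<forall>Q\<in>X. \<forall>b. hcoords b Q \<longrightarrow> G b \<noteq> 0 \<longrightarrow> \<phi> Q = hc (G b)" by blast
  have "\<exists>k. G a $ k \<noteq> 0" using G(3) by (auto simp: vec_eq_iff)
  thus "\<exists>d F. (\<forall>k. multihom d (F k)) \<and> (\<exists>k. \<not> vanishes_at (F k) P) \<and>
     (\<forall>Q\<in>X. \<forall>b. hcoords b Q \<and> (\<chi> k. F k b) \<noteq> 0 \<longrightarrow> \<phi> Q = hc (\<chi> k. F k b))"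
    using G by (intro exI[of _ d] exI[of _ "\<lambda>k a. G a $ k"]) (auto simp: vanishes_at_def vec_lambda_eta)
qed

lemma phi_regular: "regular_on del_pezzo (\<lambda>P. fib_phi P j)"
proof (rule regularI)
  fix P assume P: "P \<in> del_pezzo"
  obtain a where a: "hcoords a P" using hcoords_ex by blast
  have i: "bl_coords a" by (rule incI[OF P a])
  interpret A: fib_coords "fib_lin a" by (rule fib_coords_lin[OF i])
  show "\<exists>d G a. (\<forall>k. multihom d (\<lambda>a. G a $ k)) \<and> hcoords a P \<and> G a \<noteq> 0 \<and>
     (\<forall>Q\<in>del_pezzo. \<forall>b. hcoords b Q \<longrightarrow> G b \<noteq> 0 \<longrightarrow> fib_phi Q j = hc (G b))"
  proof (cases "j = S")
    case False
    show ?thesis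
      by (rule exI, rule exI[of _ "\<lambda>a. fib_lin a j"], rule exI[of _ a])
         (use mh_lin[OF False] a A.nz False phi_lin in auto)
  next
    case True
    obtain n where n: "fib_chart n (fib_lin a) \<noteq> 0" using A.chart_ex by blast
    obtain d where d: "\<forall>k. multihom d (\<lambda>a. fib_chart n (fib_lin a) $ k)" using mh_chart by blast
    show ?thesis
      by (rule exI[of _ d], rule exI[of _ "\<lambda>a. fib_chart n (fib_lin a)"], rule exI[of _ a])
         (use d a n True phi_chart in auto)
  qed
qed

lemma phi_morphism_exists: "\<exists>\<Phi>. is_phi_morphism \<Phi>"
  unfolding is_phi_morphism_def morphism_between_def
proof (intro exI[of _ fib_phi] conjI ballI allI impI)
  show "fib_phi \<in> del_pezzo \<rightarrow> Lambda_prod" using phi_Lambda by (rule funcsetI)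
  show "regular_on del_pezzo (\<lambda>P. fib_phi P j)" for j by (rule phi_regular)
  show "fib_phi P j = hc (phi_formula x j)"
    if "P \<in> del_pezzo" "x \<noteq> 0 \<and> P Pt = hc x \<and> (\<forall>j. phi_formula x j \<noteq> 0)" for P x j
    using that by (intro phi_formula_agrees) simp_all
qed

end

theory Submission
  imports Defs
begin

text \<open>The zero locus is the image: the first four equations say that the four lines through the
  blown-up points are concurrent, and three others then determine \<open>s\<close>.
  Each equation involves three factors and is linear in each of them. So near a point of the image,
  for a suitable pair of factors, the three equations that involve this pair determine the other
  three coordinates as functions of the two. Modulo these three equations every \<open>f\<close> is a
  function of the two kept coordinates alone; it vanishes if \<open>f\<close> vanishes on the surface. An
  arbitrary morphism that satisfies the formulas equals \<open>fib_phi\<close> by continuity.\<close>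

text \<open>Fibres of two different fibrations among the five have intersection number 1, so each
  pair gives a birational morphism from the surface to a product of two lines. It contracts three
  disjoint curves. Keeping that pair of factors and solving for the others inverts it, except at the
  three image points. Since generators are needed at every point, also on the contracted curves,
  several pairs must be combined. Uniqueness has a different obstacle: the prescribed formulas say
  nothing over the four blown-up points, so the values there are recovered as limits along a curve,
  chosen separately for each such point of the surface.\<close>

declare vector_3 [simp]

lemma vector_3_eq_0 [simp]: "(vector [x, y, z] :: 'a::zero^3) = 0 \<longleftrightarrow> x = 0 \<and> y = 0 \<and> z = 0"
  by (simp add: vec_eq_iff forall_3)

section \<open>Multihomogeneous functions\<close>

lemma poly_fun_prod:
  assumes "finite A" "\<And>i. i \<in> A \<Longrightarrow> poly_fun (f i)"
  shows "poly_fun (\<lambda>a. \<Prod>i\<in>A. f i a)"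
  using assms by (induction A rule: finite_induct) (auto intro: poly_fun.intros)

lemma multihom_one: "multihom (\<lambda>_. 0) (\<lambda>a. 1)"
  by (simp add: multihom_def poly_fun.const)

lemma multihom_power:
  assumes "multihom d f"
  shows "\<exists>e. multihom e (\<lambda>a. f a ^ n)"
proof (induction n)
  case 0
  show ?case using multihom_one by auto
next
  case (Suc n)
  thus ?case using mh_mult[OF assms] by (auto simp del: One_nat_def)
qed

lemma multihom_prod:
  assumes "finite A" "\<And>i. i \<in> A \<Longrightarrow> \<exists>d. multihom d (f i)"
  shows "\<exists>d. multihom d (\<lambda>a. \<Prod>i\<in>A. f i a)"
  using assms
proof (induction A rule: finite_induct)
  case empty
  show ?case using multihom_one by auto
next
  case (insert i A)
  then obtain d e where "multihom d (f i)" "multihom e (\<lambda>a. \<Prod>i\<in>A. f i a)" by blast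
  from mh_mult[OF this] show ?case using insert by auto
qed

lemma hcoords_scale:
  assumes "hcoords a P" "hcoords b P"
  obtains c where "\<And>i. c i \<noteq> 0" "b = (\<lambda>i. c i *s a i)"
proof -
  have "\<forall>i. \<exists>c. c \<noteq> 0 \<and> b i = c *s a i"
    using assms hc_eqD unfolding hcoords_def by metis
  then obtain c where "\<And>i. c i \<noteq> 0" "\<And>i. b i = c i *s a i" by metis
  thus ?thesis using that[of c] by auto
qed

lemma vanishes_at_iff:
  assumes "multihom d f" "hcoords a P"
  shows "vanishes_at f P \<longleftrightarrow> f a = 0"
proof
  assume "f a = 0"
  show "vanishes_at f P" unfolding vanishes_at_def
  proof (intro allI impI)
    fix b assume "hcoords b P"
    then obtain c where "b = (\<lambda>i. c i *s a i)" using hcoords_scale assms(2) by blast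
    thus "f b = 0" using assms(1) \<open>f a = 0\<close> by (simp add: multihom_def)
  qed
qed (use assms in \<open>auto simp: vanishes_at_def\<close>)

section \<open>Regular maps that agree along a curve\<close>

lemma isCont_poly_fun:
  fixes \<gamma> :: "complex \<Rightarrow> 'i \<Rightarrow> complex^3"
  assumes "poly_fun f" "\<And>i. isCont (\<lambda>\<tau>. \<gamma> \<tau> i) t"
  shows "isCont (\<lambda>\<tau>. f (\<gamma> \<tau>)) t"
  using assms(1) by induction (auto intro!: continuous_intros assms(2))

lemma isCont_eq_0_at:
  fixes m :: "complex \<Rightarrow> complex"
  assumes "isCont m t" "\<forall>\<^sub>F \<tau> in at t. m \<tau> = 0"
  shows "m t = 0"
proof -
  have "(m \<longlongrightarrow> 0) (at t)" by (rule tendsto_eventually) (rule assms(2))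
  thus ?thesis using assms(1) LIM_unique unfolding isCont_def by blast
qed

lemma hc_eq_minor:
  assumes "u \<noteq> 0" "v \<noteq> 0" "hc u = hc v"
  shows "u $ k * v $ l = u $ l * v $ k"
  using hc_eqD[OF assms] by auto

text \<open>Near \<open>P\<close> both maps have polynomial representatives. Along the curve the 2
  by 2 minors of the two triples are continuous and vanish for small nonzero parameters, hence also
  at 0, which means that the two values agree. Continuity in the complex topology takes the place of
  a density argument.\<close>

lemma regular_on_agree:
  fixes \<gamma> :: "complex \<Rightarrow> 'i::finite \<Rightarrow> complex^3"
  assumes "regular_on X \<phi>" "regular_on X \<psi>" "P \<in> X" "hcoords (\<gamma> 0) P"
    and cont: "\<And>i. isCont (\<lambda>\<tau>. \<gamma> \<tau> i) 0"
    and agree: "\<forall>\<^sub>F \<tau> in at 0. \<exists>Q\<in>X. hcoords (\<gamma> \<tau>) Q \<and> \<phi> Q = \<psi> Q"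
  shows "\<phi> P = \<psi> P"
proof -
  have local_rep: "\<exists>F. (\<forall>k. poly_fun (F k)) \<and> (\<chi> k. F k (\<gamma> 0)) \<noteq> 0 \<and>
      (\<forall>Q\<in>X. \<forall>b. hcoords b Q \<and> (\<chi> k. F k b) \<noteq> 0 \<longrightarrow> \<theta> Q = hc (\<chi> k. F k b))"
    if "regular_on X \<theta>" for \<theta>
  proof -
    have "\<exists>d F. (\<forall>k::3. multihom d (F k)) \<and> (\<exists>k. \<not> vanishes_at (F k) P) \<and>
        (\<forall>Q\<in>X. \<forall>b. hcoords b Q \<and> (\<chi> k. F k b) \<noteq> 0 \<longrightarrow> \<theta> Q = hc (\<chi> k. F k b))"
      using that assms(3) unfolding regular_on_def by (rule bspec)
    then obtain d F k where F: "\<forall>k::3. multihom d (F k)" "\<not> vanishes_at (F k) P"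
        "\<forall>Q\<in>X. \<forall>b. hcoords b Q \<and> (\<chi> k. F k b) \<noteq> 0 \<longrightarrow> \<theta> Q = hc (\<chi> k. F k b)"
      by (elim exE conjE) (rule that; assumption)
    hence "F k (\<gamma> 0) \<noteq> 0" using vanishes_at_iff[OF _ assms(4)] F(1,2) by blast
    hence "(\<chi> k. F k (\<gamma> 0)) \<noteq> 0" by (auto simp: vec_eq_iff)
    moreover have "\<forall>k. poly_fun (F k)" using F(1) by (simp add: multihom_def)
    ultimately show ?thesis using F(3) by (intro exI[of _ F] conjI)
  qed
  obtain F where F: "\<And>k. poly_fun (F k)" "(\<chi> k. F k (\<gamma> 0)) \<noteq> 0"
      "\<And>Q b. Q \<in> X \<Longrightarrow> hcoords b Q \<Longrightarrow> (\<chi> k. F k b) \<noteq> 0 \<Longrightarrow> \<phi> Q = hc (\<chi> k. F k b)"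
    using local_rep[OF assms(1)] by blast
  obtain G where G: "\<And>k. poly_fun (G k)" "(\<chi> k. G k (\<gamma> 0)) \<noteq> 0"
      "\<And>Q b. Q \<in> X \<Longrightarrow> hcoords b Q \<Longrightarrow> (\<chi> k. G k b) \<noteq> 0 \<Longrightarrow> \<psi> Q = hc (\<chi> k. G k b)"
    using local_rep[OF assms(2)] by blast
  have ev: "\<forall>\<^sub>F \<tau> in at 0. (\<chi> k. H k (\<gamma> \<tau>)) \<noteq> 0"
    if H: "\<And>k. poly_fun (H k)" "(\<chi> k. H k (\<gamma> 0)) \<noteq> 0" for H :: "3 \<Rightarrow> _"
  proof -
    obtain k where "H k (\<gamma> 0) \<noteq> 0" using H(2) by (auto simp: vec_eq_iff)
    hence "\<forall>\<^sub>F \<tau> in at 0. H k (\<gamma> \<tau>) \<noteq> 0"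
      by (rule tendsto_imp_eventually_ne[OF isCont_poly_fun[OF H(1) cont, unfolded isCont_def]])
    thus ?thesis
    proof (rule eventually_mono)
      fix \<tau> assume "H k (\<gamma> \<tau>) \<noteq> 0"
      thus "(\<chi> k. H k (\<gamma> \<tau>)) \<noteq> 0" by (metis vec_lambda_beta zero_index)
    qed
  qed
  have "F k (\<gamma> 0) * G l (\<gamma> 0) - F l (\<gamma> 0) * G k (\<gamma> 0) = 0" for k l
  proof (rule isCont_eq_0_at[where t = 0 and m = "\<lambda>\<tau>. F k (\<gamma> \<tau>) * G l (\<gamma> \<tau>) - F l (\<gamma> \<tau>) * G k (\<gamma> \<tau>)"])
    show "isCont (\<lambda>\<tau>. F k (\<gamma> \<tau>) * G l (\<gamma> \<tau>) - F l (\<gamma> \<tau>) * G k (\<gamma> \<tau>)) 0"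
      by (intro continuous_intros isCont_poly_fun F G cont)
    show "\<forall>\<^sub>F \<tau> in at 0. F k (\<gamma> \<tau>) * G l (\<gamma> \<tau>) - F l (\<gamma> \<tau>) * G k (\<gamma> \<tau>) = 0"
      using agree ev[of F, OF F(1,2)] ev[of G, OF G(1,2)]
    proof eventually_elim
      case (elim \<tau>)
      then obtain Q where "Q \<in> X" "hcoords (\<gamma> \<tau>) Q" "\<phi> Q = \<psi> Q" by blast
      with F(3)[of Q, OF _ _ elim(2)] G(3)[of Q, OF _ _ elim(3)]
      have "hc (\<chi> k. F k (\<gamma> \<tau>)) = hc (\<chi> k. G k (\<gamma> \<tau>))" by simp
      from hc_eq_minor[OF elim(2,3) this, of k l] show ?case by simp
    qed
  qed
  hence "hc (\<chi> k. F k (\<gamma> 0)) = hc (\<chi> k. G k (\<gamma> 0))"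
    by (intro hc_eqI F(2) G(2)) simp_all
  thus ?thesis using F(3)[OF assms(3,4) F(2)] G(3)[OF assms(3,4) G(2)] by simp
qed

section \<open>Uniqueness of the morphism\<close>

text \<open>Coordinates of the line joining two points and, dually, of the common point of two
  lines; for nonzero vectors it vanishes exactly when the two points or lines coincide.\<close>

definition cross :: "complex^3 \<Rightarrow> complex^3 \<Rightarrow> complex^3" where
  "cross p x = vector [p $ 2 * x $ 3 - p $ 3 * x $ 2, p $ 3 * x $ 1 - p $ 1 * x $ 3,
     p $ 1 * x $ 2 - p $ 2 * x $ 1]"

lemma incident_cross: "incident p (cross p x)" "incident x (cross p x)"
  by (simp_all add: incident_def cross_def sum_3 algebra_simps)

lemma cross_cross:
  "cross x (cross l e) = (\<Sum>k\<in>UNIV. e $ k * x $ k) *s l - (\<Sum>k\<in>UNIV. l $ k * x $ k) *s e"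
  by (simp add: cross_def vec_eq_iff forall_3 sum_3 algebra_simps)

lemma incident_unique:
  assumes "incident p l" "incident x l" "l \<noteq> 0" "cross p x \<noteq> 0"
  shows "\<exists>c. c \<noteq> 0 \<and> l = c *s cross p x"
proof -
  have "l $ 1 * p $ 1 + l $ 2 * p $ 2 + l $ 3 * p $ 3 = 0"
    "l $ 1 * x $ 1 + l $ 2 * x $ 2 + l $ 3 * x $ 3 = 0"
    using assms(1,2) by (simp_all add: incident_def sum_3)
  hence "hc (cross p x) = hc l"
    by (intro hc_eqI assms) (simp_all add: cross_def, algebra+)
  thus ?thesis using hc_eqD assms by blast
qed

text \<open>The value 0 at \<open>Pt\<close> is a placeholder, since \<open>Pt\<close> indexes the
  plane itself; statements about blown-up points exclude this index.\<close>

definition base_pt :: "bl \<Rightarrow> complex^3" where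
  "base_pt i = (case i of Pt \<Rightarrow> 0 | L1 \<Rightarrow> vector [1, 0, 0] | L2 \<Rightarrow> vector [0, 1, 0]
     | L3 \<Rightarrow> vector [0, 0, 1] | L4 \<Rightarrow> vector [1, 1, 1])"

lemma cross_base_pt:
  "cross (base_pt L1) (vector [p, q, r]) = 0 \<longleftrightarrow> q = 0 \<and> r = 0"
  "cross (base_pt L2) (vector [p, q, r]) = 0 \<longleftrightarrow> p = 0 \<and> r = 0"
  "cross (base_pt L3) (vector [p, q, r]) = 0 \<longleftrightarrow> p = 0 \<and> q = 0"
  "cross (base_pt L4) (vector [p, q, r]) = 0 \<longleftrightarrow> p = q \<and> q = r"
  by (auto simp: cross_def base_pt_def)

lemma vector_3_eta: "(x :: complex^3) = vector [x $ 1, x $ 2, x $ 3]"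
  by (simp add: vec_eq_iff forall_3)

lemma cross_base_pt_unique:
  assumes "x \<noteq> 0" "i \<noteq> Pt" "j \<noteq> Pt" "cross (base_pt i) x = 0" "cross (base_pt j) x = 0"
  shows "i = j"
proof -
  obtain p q r where x: "x = vector [p, q, r]" using vector_3_eta by blast
  show ?thesis using assms cross_base_pt unfolding x by (cases i; cases j; simp; blast)
qed

lemma cross_eq_0D:
  assumes "cross p x = 0" "p \<noteq> 0" "x \<noteq> 0"
  shows "\<exists>c. x = c *s p"
proof -
  have "hc p = hc x" by (rule hc_eqI) (use assms in \<open>simp_all add: cross_def mult.commute\<close>)
  thus ?thesis using hc_eqD assms by blast
qed

section \<open>Homogeneous coordinates on the blow-up\<close>

lemma bl_coords_iff:
  "bl_coords a \<longleftrightarrow> (\<forall>i. a i \<noteq> 0) \<and> (\<forall>i. i \<noteq> Pt \<longrightarrow> incident (base_pt i) (a i) \<and> incident (a Pt) (a i))"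
proof -
  have all: "(\<forall>i. i \<noteq> Pt \<longrightarrow> R i) \<longleftrightarrow> R L1 \<and> R L2 \<and> R L3 \<and> R L4" for R
    by (metis bl.exhaust bl.distinct)
  have base: "incident (base_pt L1) l \<longleftrightarrow> l $ 1 = 0" "incident (base_pt L2) l \<longleftrightarrow> l $ 2 = 0"
    "incident (base_pt L3) l \<longleftrightarrow> l $ 3 = 0" "incident (base_pt L4) l \<longleftrightarrow> l $ 1 + l $ 2 + l $ 3 = 0" for l
    by (simp_all add: incident_def base_pt_def sum_3)
  have pt: "incident x l \<longleftrightarrow> l $ 1 * x $ 1 + l $ 2 * x $ 2 + l $ 3 * x $ 3 = 0" for x l
    by (simp add: incident_def sum_3)
  show ?thesis unfolding bl_coords_def all base pt[of "a Pt"]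
    by safe (simp_all only: mult_zero_left add_0_left add_0_right)
qed

lemma del_pezzo_iff:
  assumes "hcoords a P"
  shows "P \<in> del_pezzo \<longleftrightarrow> bl_coords a"
proof
  assume a: "bl_coords a"
  show "P \<in> del_pezzo" unfolding del_pezzo_def
  proof (intro CollectI allI impI)
    fix b assume "hcoords b P"
    then obtain c where b: "b = (\<lambda>i. c i *s a i)" using hcoords_scale assms by blast
    have scale: "incident x l \<Longrightarrow> incident (e *s x) (c *s l)" for e c x l
    proof -
      assume "incident x l"
      hence "(c * e) * (l $ 1 * x $ 1 + l $ 2 * x $ 2 + l $ 3 * x $ 3) = 0"
        by (simp add: incident_def sum_3)
      thus ?thesis by (simp add: incident_def sum_3 algebra_simps)
    qed
    have "incident (base_pt i) (b i)" "incident (b Pt) (b i)" if "i \<noteq> Pt" for i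
      using a that scale[of "base_pt i" "a i" 1 "c i"] scale[of "a Pt" "a i" "c Pt" "c i"]
      by (auto simp: bl_coords_iff b)
    from this[of L1] this[of L2] this[of L3] this[of L4]
    show "\<forall>(i, p) \<in> {(L1, vector [1, 0, 0]), (L2, vector [0, 1, 0]),
        (L3, vector [0, 0, 1]), (L4, vector [1, 1, 1])}. incident p (b i) \<and> incident (b Pt) (b i)"
      by (simp add: base_pt_def)
  qed
qed (rule incI[OF _ assms])

text \<open>Each of the first four formulas fails only at the centre of its projection, and the last
  one only at the base points of the pencil of conics, which are the same four points.\<close>

lemma phi_formula_nonzero:
  assumes "\<And>i. i \<noteq> Pt \<Longrightarrow> cross (base_pt i) x \<noteq> 0"
  shows "phi_formula x j \<noteq> 0"
proof -
  obtain p q r where x: "x = vector [p, q, r]" using vector_3_eta by blast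
  have ne: "\<not> (q = 0 \<and> r = 0)" "\<not> (p = 0 \<and> r = 0)" "\<not> (p = 0 \<and> q = 0)" "\<not> (p = q \<and> q = r)"
    using assms[of L1] assms[of L2] assms[of L3] assms[of L4] by (simp_all only: x cross_base_pt bl.distinct simp_thms)
  show ?thesis
  proof (cases j)
    case S
    have "\<not> (p * (r - q) = 0 \<and> q * (p - r) = 0 \<and> r * (q - p) = 0)" using ne by auto
    thus ?thesis by (simp add: phi_formula_def x S)
  qed (simp_all add: phi_formula_def x, use ne in \<open>metis+\<close>)
qed

text \<open>If \<open>x\<close> is the \<open>i\<close>-th blown-up point, then it is moved along the given line through it.
  This leaves the \<open>i\<close>-th exceptional coordinate unchanged and moves the others continuously.\<close>

lemma phi_morphism_unique:
  assumes \<Phi>: "is_phi_morphism \<Phi>" and P: "P \<in> del_pezzo"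
  shows "\<Phi> P = fib_phi P"
proof
  fix j
  obtain a where a: "hcoords a P" using hcoords_ex by blast
  have nz: "a i \<noteq> 0" and inc: "i \<noteq> Pt \<Longrightarrow> incident (base_pt i) (a i)" "i \<noteq> Pt \<Longrightarrow> incident (a Pt) (a i)" for i
    using del_pezzo_iff[OF a] P by (auto simp: bl_coords_iff)
  have generic: "\<Phi> Q j = fib_phi Q j" if "Q \<in> del_pezzo" "hcoords b Q"
      "\<And>i. i \<noteq> Pt \<Longrightarrow> cross (base_pt i) (b Pt) \<noteq> 0" for b Q
    using \<Phi> phi_formula_agrees[of Q "b Pt" j] phi_formula_nonzero[of "b Pt"] that
    by (auto simp: is_phi_morphism_def hcoords_def)
  show "\<Phi> P j = fib_phi P j"
  proof (cases "\<forall>i. i \<noteq> Pt \<longrightarrow> cross (base_pt i) (a Pt) \<noteq> 0")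
    case True
    thus ?thesis using generic[OF P a] by blast
  next
    case False
    then obtain i0 where i0: "i0 \<noteq> Pt" "cross (base_pt i0) (a Pt) = 0" by blast
    have other: "cross (base_pt i) (a Pt) \<noteq> 0" if "i \<noteq> Pt" "i \<noteq> i0" for i
      using cross_base_pt_unique[OF nz[of Pt] i0(1) that(1) i0(2)] that(2) by blast
    have "\<exists>c. i \<noteq> Pt \<longrightarrow> i \<noteq> i0 \<longrightarrow> a i = c *s cross (base_pt i) (a Pt)" for i
      using incident_unique[OF inc(1) inc(2) nz other, of i] by blast
    hence "\<exists>e. \<forall>i. i \<noteq> Pt \<longrightarrow> i \<noteq> i0 \<longrightarrow> a i = e i *s cross (base_pt i) (a Pt)"
      by (intro choice) blast
    then obtain e where e: "\<And>i. i \<noteq> Pt \<Longrightarrow> i \<noteq> i0 \<Longrightarrow> a i = e i *s cross (base_pt i) (a Pt)" by blast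
    obtain n where n: "a Pt $ n \<noteq> 0" using nz[of Pt] by (auto simp: vec_eq_iff)
    \<comment> \<open>As a line, \<open>axis n 1\<close> is the n-th coordinate line, which misses
      the point \<open>a Pt\<close>. It meets the line \<open>a i0\<close> in \<open>u\<close>, so
      \<open>u\<close> is a second point of that line and gives the direction of motion.\<close>
    define u where "u = cross (a i0) (axis n 1)"
    have u: "incident u (a i0)"
      unfolding u_def incident_def cross_def by (simp add: sum_3 algebra_simps)
    have sum_axis: "(\<Sum>k\<in>UNIV. axis n 1 $ k * y $ k) = y $ n" for y :: "complex^3"
      using exhaust_3[of n] by (auto simp: axis_def sum_3)
    have "cross (a Pt) u = a Pt $ n *s a i0"
      using cross_cross[of "a Pt" "a i0" "axis n 1"] inc(2)[OF i0(1)] sum_axis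
      by (simp add: u_def incident_def)
    hence xu: "cross (a Pt) u \<noteq> 0" using n nz by simp
    have base: "base_pt i0 \<noteq> 0" using i0(1) by (cases i0) (simp_all add: base_pt_def)
    obtain c where c: "a Pt = c *s base_pt i0" using cross_eq_0D[OF i0(2) base nz] by blast
    have "cross (a Pt) u = c *s cross (base_pt i0) u"
      by (simp add: c cross_def vec_eq_iff forall_3 algebra_simps)
    hence pu: "cross (base_pt i0) u \<noteq> 0" using xu by auto
    define x where "x = (\<lambda>\<tau>. a Pt + \<tau> *s u)"
    define \<gamma> where "\<gamma> = (\<lambda>\<tau> i. if i = Pt then x \<tau> else if i = i0 then a i0
      else e i *s cross (base_pt i) (x \<tau>))"
    have x0: "x 0 = a Pt" by (simp add: x_def)
    have \<gamma>0: "\<gamma> 0 = a" using e by (auto simp: \<gamma>_def x0)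
    have contk: "isCont (\<lambda>\<tau>. x \<tau> $ k) 0" for k unfolding x_def by (auto intro!: continuous_intros)
    have contx: "isCont x 0"
      unfolding isCont_def by (rule vec_tendstoI) (rule contk[unfolded isCont_def])
    have contck: "isCont (\<lambda>\<tau>. cross p (x \<tau>) $ k) 0" for p k
    proof -
      have "k = 1 \<or> k = 2 \<or> k = 3" using exhaust_3 by blast
      thus ?thesis by (elim disjE) (auto simp: cross_def intro!: continuous_intros contk)
    qed
    have contc: "isCont (\<lambda>\<tau>. cross p (x \<tau>)) 0" for p
      unfolding isCont_def by (rule vec_tendstoI) (rule contck[unfolded isCont_def])
    have "isCont (\<lambda>\<tau>. (c *s cross p (x \<tau>)) $ k) 0" for c p k
      using isCont_mult[OF continuous_const contck] by simp
    hence contec: "isCont (\<lambda>\<tau>. c *s cross p (x \<tau>)) 0" for c p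
      unfolding isCont_def by (rule vec_tendstoI)
    have cont: "isCont (\<lambda>\<tau>. \<gamma> \<tau> i) 0" for i
      using contx contec by (cases "i = Pt"; cases "i = i0") (simp_all add: \<gamma>_def)
    \<comment> \<open>For \<open>i0\<close> the constant term is zero and the cross product is
      \<tau> times a nonzero vector; for the other indices it is nonzero at 0 and stays so
      nearby.\<close>
    have move: "\<forall>\<^sub>F \<tau> in at 0. i \<noteq> Pt \<longrightarrow> cross (base_pt i) (x \<tau>) \<noteq> 0" for i
    proof (cases "i = i0")
      case True
      have "cross (base_pt i0) (x \<tau>) = cross (base_pt i0) (a Pt) + \<tau> *s cross (base_pt i0) u" for \<tau>
        by (simp add: cross_def x_def vec_eq_iff forall_3 algebra_simps)
      hence "cross (base_pt i0) (x \<tau>) \<noteq> 0" if "\<tau> \<noteq> 0" for \<tau> using pu that i0 by simp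
      thus ?thesis using True by (auto simp: eventually_at_filter)
    next
      case False
      show ?thesis
      proof (cases "i = Pt")
        case i: False
        show ?thesis
          using tendsto_imp_eventually_ne[OF contc[of "base_pt i", unfolded isCont_def x0] other[OF i False]]
          by eventually_elim auto
      qed auto
    qed
    have "\<forall>\<^sub>F \<tau> in at 0. \<forall>i. i \<noteq> Pt \<longrightarrow> cross (base_pt i) (x \<tau>) \<noteq> 0"
      by (intro eventually_all_finite move)
    hence "\<forall>\<^sub>F \<tau> in at 0. \<exists>Q\<in>del_pezzo. hcoords (\<gamma> \<tau>) Q \<and> \<Phi> Q j = fib_phi Q j"
    proof eventually_elim
      case (elim \<tau>)
      have e0: "e i \<noteq> 0" if "i \<noteq> Pt" "i \<noteq> i0" for i using e[OF that] nz[of i] by auto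
      have cross0: "cross p 0 = 0" for p by (simp add: cross_def)
      have x: "x \<tau> \<noteq> 0" using elim i0(1) cross0 by metis
      have scale: "incident y (c *s l)" if "incident y l" for y l c
      proof -
        have "(\<Sum>k\<in>UNIV. (c *s l) $ k * y $ k) = c * (\<Sum>k\<in>UNIV. l $ k * y $ k)"
          by (simp add: sum_distrib_left mult.assoc)
        thus ?thesis using that by (simp add: incident_def)
      qed
      have ix: "incident (x \<tau>) (a i0)"
      proof -
        have "(\<Sum>k\<in>UNIV. a i0 $ k * x \<tau> $ k) =
            (\<Sum>k\<in>UNIV. a i0 $ k * a Pt $ k) + \<tau> * (\<Sum>k\<in>UNIV. a i0 $ k * u $ k)"
          by (simp add: x_def sum_3 algebra_simps)
        thus ?thesis using u inc(2)[OF i0(1)] by (simp add: incident_def)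
      qed
      have nz\<gamma>: "\<gamma> \<tau> i \<noteq> 0" for i
        using e0[of i] elim x nz by (cases "i = Pt"; cases "i = i0") (simp_all add: \<gamma>_def)
      hence h: "hcoords (\<gamma> \<tau>) (\<lambda>i. hc (\<gamma> \<tau> i))" by (simp add: hcoords_def)
      have "incident (base_pt i) (\<gamma> \<tau> i) \<and> incident (\<gamma> \<tau> Pt) (\<gamma> \<tau> i)" if "i \<noteq> Pt" for i
        using that inc(1)[OF that] ix scale[OF incident_cross(1)] scale[OF incident_cross(2)]
        by (cases "i = i0") (simp_all add: \<gamma>_def)
      hence "bl_coords (\<gamma> \<tau>)" unfolding bl_coords_iff using nz\<gamma> by simp
      hence "(\<lambda>i. hc (\<gamma> \<tau> i)) \<in> del_pezzo" using del_pezzo_iff h by blast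
      moreover have "\<gamma> \<tau> Pt = x \<tau>" by (simp add: \<gamma>_def)
      ultimately show ?case using generic h elim by metis
    qed
    moreover have "regular_on del_pezzo (\<lambda>Q. \<Phi> Q j)"
      using \<Phi> by (simp add: is_phi_morphism_def morphism_between_def)
    ultimately show ?thesis
      using regular_on_agree[OF _ phi_regular P, of "\<lambda>Q. \<Phi> Q j" \<gamma> j] cont \<gamma>0 a by simp
  qed
qed


section \<open>The image is the common zero locus\<close>

text \<open>Each of the ten triples of factors occurs in exactly one equation, so every pair of
  factors lies in three of them, one for each remaining factor.\<close>

definition eqns :: "((factor \<Rightarrow> complex^3) \<Rightarrow> complex) list" where
  "eqns =
    [\<lambda>a. a V $ 1 * a W $ 1 * a Z $ 1 - a V $ 2 * a W $ 2 * a Z $ 2,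
     \<lambda>a. a V $ 3 * a W $ 1 * a T $ 1 - a V $ 2 * a W $ 3 * a T $ 3,
     \<lambda>a. a V $ 1 * a Z $ 3 * a T $ 3 + a V $ 3 * a Z $ 2 * a T $ 2,
     \<lambda>a. a W $ 3 * a Z $ 1 * a T $ 2 + a W $ 2 * a Z $ 3 * a T $ 1,
     \<lambda>a. a T $ 1 * a V $ 1 * a S $ 2 - a T $ 2 * a V $ 2 * a S $ 1,
     \<lambda>a. a T $ 1 * a Z $ 2 * a S $ 3 - a T $ 3 * a Z $ 1 * a S $ 1,
     \<lambda>a. a T $ 3 * a W $ 2 * a S $ 2 - a T $ 2 * a W $ 1 * a S $ 3,
     \<lambda>a. a V $ 3 * a W $ 2 * a S $ 1 - a V $ 1 * a W $ 3 * a S $ 3,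
     \<lambda>a. a V $ 2 * a Z $ 3 * a S $ 3 + a V $ 3 * a Z $ 1 * a S $ 2,
     \<lambda>a. a W $ 3 * a Z $ 2 * a S $ 2 + a W $ 1 * a Z $ 3 * a S $ 1]"

definition on_lines :: "(factor \<Rightarrow> complex^3) \<Rightarrow> bool" where
  "on_lines a \<longleftrightarrow> (\<forall>j. a j $ 3 = a j $ 2 - a j $ 1)"

lemma on_lines_third: "on_lines a \<Longrightarrow> a j $ 3 = a j $ 2 - a j $ 1"
  by (simp add: on_lines_def)

lemma multihom_trilinear:
  "multihom (\<lambda>i. (if i = j then 1 else 0) + (if i = k then 1 else 0) + (if i = l then 1 else 0))
     (\<lambda>a. a j $ p * a k $ q * a l $ r)"
  by (intro mh_mult mh_coord)

lemma multihom_eqns: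
  assumes "e \<in> set eqns"
  shows "\<exists>d. multihom d e"
proof -
  have "\<exists>d. multihom d (\<lambda>a. a j $ p * a k $ q * a l $ r + a j $ p' * a k $ q' * a l $ r')"
    "\<exists>d. multihom d (\<lambda>a. a j $ p * a k $ q * a l $ r - a j $ p' * a k $ q' * a l $ r')"
    for j k l p q r p' q' r'
    using mh_add[OF multihom_trilinear multihom_trilinear]
      mh_diff[OF multihom_trilinear multihom_trilinear] by blast+
  thus ?thesis using assms unfolding eqns_def by auto
qed

lemma Lambda_prod_iff:
  assumes "hcoords a P"
  shows "P \<in> Lambda_prod \<longleftrightarrow> on_lines a"
proof
  assume "P \<in> Lambda_prod"
  hence "\<forall>j. a j $ 1 - a j $ 2 + a j $ 3 = 0" using assms by (auto simp: Lambda_prod_def)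
  thus "on_lines a" unfolding on_lines_def by (simp add: algebra_simps eq_diff_eq add_eq_0_iff)
next
  assume a: "on_lines a"
  show "P \<in> Lambda_prod" unfolding Lambda_prod_def
  proof (intro CollectI allI impI)
    fix b j assume "hcoords b P"
    then obtain c where b: "b = (\<lambda>i. c i *s a i)" using hcoords_scale assms by blast
    show "b j $ 1 - b j $ 2 + b j $ 3 = 0"
      unfolding b by (rule vec_scale_line) (use a in \<open>simp add: on_lines_def\<close>)
  qed
qed

lemma hc_eq_on_line:
  assumes "u \<noteq> 0" "v \<noteq> 0" "u $ 3 = u $ 2 - u $ 1" "v $ 3 = v $ 2 - v $ 1" "u $ 1 * v $ 2 = u $ 2 * v $ 1"
  shows "hc u = hc v"
  by (rule hc_eqI[OF assms(1,2,5)]; unfold assms(3,4); use assms(5) in algebra)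

text \<open>The first four equations express that the four lines meet in one point. The value at
  \<open>S\<close> is one of three expressions in the other coordinates, and for each of them
  equations 5 to 10 follow algebraically from the first four.\<close>

lemma fib_val_eqns:
  assumes "bl_coords a" "e \<in> set eqns"
  shows "e (fib_val a) = 0"
proof -
  define b where "b = fib_lin a"
  interpret fib_coords b unfolding b_def by (rule fib_coords_lin[OF assms(1)])
  define n where "n = (LEAST n. fib_chart n b \<noteq> 0)"
  have val: "fib_val a V = b V" "fib_val a W = b W" "fib_val a Z = b Z" "fib_val a T = b T"
      "fib_val a S = fib_chart n b"
    by (simp_all add: fib_val_def b_def n_def)
  have r1: "b V $ 1 * b W $ 1 * b Z $ 1 = b V $ 2 * b W $ 2 * b Z $ 2"
  proof -
    have x: "a Pt $ 1 \<noteq> 0 \<or> a Pt $ 2 \<noteq> 0 \<or> a Pt $ 3 \<noteq> 0" and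
      l: "a L1 $ 2 * a Pt $ 2 + a L1 $ 3 * a Pt $ 3 = 0" "a L2 $ 1 * a Pt $ 1 + a L2 $ 3 * a Pt $ 3 = 0"
        "a L3 $ 1 * a Pt $ 1 + a L3 $ 2 * a Pt $ 2 = 0"
      using assms(1) nz3 unfolding bl_coords_def by blast+
    \<comment> \<open>Its multiple by each coordinate of the point lies in the ideal of the three
      incidence relations, and some coordinate is nonzero.\<close>
    let ?A = "a L3 $ 2 * a L1 $ 3 * a L2 $ 1 + a L3 $ 1 * a L1 $ 2 * a L2 $ 3"
    have "?A * a Pt $ 1 = 0" "?A * a Pt $ 2 = 0" "?A * a Pt $ 3 = 0" using l by algebra+
    hence "?A = 0" using x by auto
    thus ?thesis by (simp add: b_def fib_lin_def eq_neg_iff_add_eq_0)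
  qed
  define v1 v2 w1 w2 z1 z2 t1 t2 where "v1 = b V $ 1" "v2 = b V $ 2" "w1 = b W $ 1" "w2 = b W $ 2"
    "z1 = b Z $ 1" "z2 = b Z $ 2" "t1 = b T $ 1" "t2 = b T $ 2"
  note d = this[symmetric]
  have r: "v1 * w1 * z1 = v2 * w2 * z2" "(v2 - v1) * w1 * t1 = v2 * (w2 - w1) * (t2 - t1)"
    "v1 * (z2 - z1) * (t2 - t1) + (v2 - v1) * z2 * t2 = 0"
    "(w2 - w1) * z1 * t2 + w2 * (z2 - z1) * t1 = 0"
    using r1 r2 r3 r4 unfolding third d by simp_all
  have n: "fib_chart n b $ 1 = (if n = 0 then t1 * v1 else if n = 1 then t1 * z2 else t2 * w1 - (t2 - t1) * w2)"
    "fib_chart n b $ 2 = (if n = 0 then t2 * v2 else if n = 1 then t1 * z2 + (t2 - t1) * z1 else t2 * w1)"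
    "fib_chart n b $ 3 = fib_chart n b $ 2 - fib_chart n b $ 1"
    by (simp_all add: fib_chart_def third d)
  define s1 s2 where "s1 = fib_chart n b $ 1" "s2 = fib_chart n b $ 2"
  note ds = this[symmetric]
  have s: "s1 = t1 * v1 \<and> s2 = t2 * v2 \<or> s1 = t1 * z2 \<and> s2 = t1 * z2 + (t2 - t1) * z1
      \<or> s1 = t2 * w1 - (t2 - t1) * w2 \<and> s2 = t2 * w1"
    using n(1,2) unfolding ds by (auto split: if_splits)
  have s5: "t1 * v1 * s2 - t2 * v2 * s1 = 0"
    and s6: "t1 * z2 * (s2 - s1) - (t2 - t1) * z1 * s1 = 0"
    and s7: "(t2 - t1) * w2 * s2 - t2 * w1 * (s2 - s1) = 0"
    and s8: "(v2 - v1) * w2 * s1 - v1 * (w2 - w1) * (s2 - s1) = 0"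
    and s9: "v2 * (z2 - z1) * (s2 - s1) + (v2 - v1) * z1 * s2 = 0"
    and s10: "(w2 - w1) * z2 * s2 + w1 * (z2 - z1) * s1 = 0"
    using s r by (elim disjE; algebra)+
  show ?thesis
    using assms(2) r s5 s6 s7 s8 s9 s10 unfolding eqns_def
    by (auto simp: val third n(3) d ds)
qed

text \<open>The point of the plane is the intersection of the lines through the first two blown-up points,
  unless both are the line \<open>x\<^sub>3 = 0\<close> joining these points.\<close>

lemma ex_bl_coords:
  assumes nz: "\<And>j. b j \<noteq> 0" and line: "on_lines b" and eqs: "\<forall>e\<in>set eqns. e b = 0"
  obtains a where "bl_coords a" "\<And>j. j \<noteq> S \<Longrightarrow> fib_lin a j = b j"
proof -
  have third: "b j $ 3 = b j $ 2 - b j $ 1" for j using line by (simp add: on_lines_def)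
  define v1 v2 w1 w2 z1 z2 t1 t2 where "v1 = b V $ 1" "v2 = b V $ 2" "w1 = b W $ 1" "w2 = b W $ 2"
    "z1 = b Z $ 1" "z2 = b Z $ 2" "t1 = b T $ 1" "t2 = b T $ 2"
  note d = this[symmetric]
  have r: "v1 * w1 * z1 - v2 * w2 * z2 = 0" "(v2 - v1) * w1 * t1 - v2 * (w2 - w1) * (t2 - t1) = 0"
    "(w2 - w1) * z1 * t2 + w2 * (z2 - z1) * t1 = 0"
    using eqs by (simp_all add: eqns_def third d)
  have nz': "v1 \<noteq> 0 \<or> v2 \<noteq> 0" "w1 \<noteq> 0 \<or> w2 \<noteq> 0" "z1 \<noteq> 0 \<or> z2 \<noteq> 0" "t1 \<noteq> 0 \<or> t2 \<noteq> 0"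
    using nz[of V] nz[of W] nz[of Z] nz[of T] unfolding nz3 third d by auto
  have "\<exists>x1 x2 x3. (x1 \<noteq> 0 \<or> x2 \<noteq> 0 \<or> x3 \<noteq> 0) \<and> w1 * x3 = w2 * x2 \<and> z1 * x1 = z2 * x3 \<and>
      v1 * x2 = v2 * x1 \<and> t1 * x1 - t2 * x2 + (t2 - t1) * x3 = 0"
  proof (cases "w2 = 0 \<and> z1 = 0")
    case True
    hence "w1 * (t2 * v2 - t1 * v1) = 0" using r(2) by algebra
    hence "t1 * v1 = t2 * v2" using True nz'(2) by simp
    \<comment> \<open>The first two lines are both x3 = 0, so the third line, v1 x2 = v2 x1, cuts
      out the point (v1 : v2 : 0).\<close>
    thus ?thesis using True nz'(1)
      by (intro exI[of _ v1] exI[of _ v2] exI[of _ 0]) (simp add: mult.commute)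
  next
    case False
    have "w2 * z2 \<noteq> 0 \<or> w1 * z1 \<noteq> 0 \<or> w2 * z1 \<noteq> 0" using False nz'(2,3) by auto
    moreover have "v1 * (w1 * z1) = v2 * (w2 * z2)" using r(1) by algebra
    moreover have "t1 * (w2 * z2) - t2 * (w1 * z1) + (t2 - t1) * (w2 * z1) = 0" using r(3) by algebra
    \<comment> \<open>The ratios x2 : x3 = w1 : w2 and x3 : x1 = z1 : z2 combine to this
      triple.\<close>
    ultimately show ?thesis
      by (intro exI[of _ "w2 * z2"] exI[of _ "w1 * z1"] exI[of _ "w2 * z1"]) simp
  qed
  then obtain x1 x2 x3 where x: "x1 \<noteq> 0 \<or> x2 \<noteq> 0 \<or> x3 \<noteq> 0" "w1 * x3 = w2 * x2" "z1 * x1 = z2 * x3"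
      "v1 * x2 = v2 * x1" "t1 * x1 - t2 * x2 + (t2 - t1) * x3 = 0" by blast
  \<comment> \<open>The four lines are read off by inverting \<open>fib_lin\<close>.\<close>
  define a :: "bl \<Rightarrow> complex^3" where "a i = (case i of Pt \<Rightarrow> vector [x1, x2, x3]
    | L1 \<Rightarrow> vector [0, - w2, w1] | L2 \<Rightarrow> vector [z1, 0, - z2] | L3 \<Rightarrow> vector [- v2, v1, 0]
    | L4 \<Rightarrow> vector [t1, - t2, t2 - t1])" for i
  show ?thesis
  proof (rule that)
    have "a i \<noteq> 0" for i using x(1) nz' by (cases i) (auto simp: a_def)
    thus "bl_coords a" using x by (simp add: bl_coords_def a_def algebra_simps)
    show "fib_lin a j = b j" if "j \<noteq> S" for j
      using that by (cases j) (simp_all add: fib_lin_def a_def vec_eq_iff forall_3 third d)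
  qed
qed

lemma fib_phi_image: "fib_phi ` del_pezzo = {P \<in> Lambda_prod. \<forall>e\<in>set eqns. vanishes_at e P}"
proof (intro equalityI subsetI)
  fix R assume "R \<in> fib_phi ` del_pezzo"
  then obtain P where P: "P \<in> del_pezzo" "R = fib_phi P" by blast
  obtain a where a: "hcoords a P" using hcoords_ex by blast
  have h: "hcoords (fib_val a) R" using phi_val[OF P(1) a] P(2) by (simp add: hcoords_def)
  have "vanishes_at e R" if "e \<in> set eqns" for e
    using vanishes_at_iff[OF _ h] multihom_eqns[OF that] fib_val_eqns[OF incI[OF P(1) a] that] by blast
  thus "R \<in> {P \<in> Lambda_prod. \<forall>e\<in>set eqns. vanishes_at e P}" using phi_Lambda P by simp
next
  fix P assume P: "P \<in> {P \<in> Lambda_prod. \<forall>e\<in>set eqns. vanishes_at e P}"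
  obtain b where b: "hcoords b P" using hcoords_ex by blast
  have nzb: "b j \<noteq> 0" and hc: "P j = hc (b j)" for j using b by (simp_all add: hcoords_def)
  have lines: "on_lines b" using Lambda_prod_iff[OF b] P by simp
  have eqs: "\<forall>e\<in>set eqns. e b = 0" using P b by (auto simp: vanishes_at_def)
  obtain a where a: "bl_coords a" and l: "\<And>j. j \<noteq> S \<Longrightarrow> fib_lin a j = b j"
    using ex_bl_coords[OF nzb lines eqs] by blast
  define Q where "Q = (\<lambda>i. hc (a i))"
  have hQ: "hcoords a Q" using a by (simp add: hcoords_def Q_def bl_coords_def)
  have Q: "Q \<in> del_pezzo" using del_pezzo_iff[OF hQ] a by simp
  interpret fib_coords "fib_lin a" by (rule fib_coords_lin[OF a])
  obtain n where n: "fib_chart n (fib_lin a) \<noteq> 0" using chart_ex by blast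
  have third': "b j $ 3 = b j $ 2 - b j $ 1" for j using lines by (simp add: on_lines_def)
  \<comment> \<open>According to \<open>n\<close>, this minor vanishes by equation 5, 6 or
    7.\<close>
  have "fib_chart n (fib_lin a) $ 1 * b S $ 2 = fib_chart n (fib_lin a) $ 2 * b S $ 1"
    using eqs by (simp add: eqns_def fib_chart_def l third') (simp add: algebra_simps)
  hence "hc (fib_chart n (fib_lin a)) = hc (b S)"
    using chart_line[of n] by (intro hc_eq_on_line n nzb third') (simp_all add: algebra_simps eq_diff_eq)
  hence "fib_phi Q S = P S" using phi_chart[OF Q hQ n] hc by simp
  moreover have "fib_phi Q j = P j" if "j \<noteq> S" for j using phi_lin[OF Q hQ that] l[OF that] hc by simp
  ultimately have "fib_phi Q = P" by (intro ext) metis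
  thus "P \<in> fib_phi ` del_pezzo" using Q by blast
qed

section \<open>Local generation of the ideal\<close>

text \<open>The identity is imposed only on \<open>D\<close>, later the set of coordinates of points
  of the product of lines, so that the line relations can be used freely without being
  generators.\<close>

definition ideal_on ::
  "('i \<Rightarrow> complex^3) set \<Rightarrow> (('i \<Rightarrow> complex^3) \<Rightarrow> complex) list \<Rightarrow> (('i \<Rightarrow> complex^3) \<Rightarrow> complex) set" where
  "ideal_on D es = {f. \<exists>h. (\<forall>k<length es. poly_fun (h k)) \<and>
     (\<forall>a\<in>D. f a = (\<Sum>k<length es. h k a * (es ! k) a))}"

lemma ideal_on_zero:
  assumes "\<And>a. a \<in> D \<Longrightarrow> f a = 0"
  shows "f \<in> ideal_on D es"
  unfolding ideal_on_def
  by (intro CollectI exI[of _ "\<lambda>_ _. 0"]) (simp add: assms poly_fun.const)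

lemma ideal_on_add:
  assumes "f \<in> ideal_on D es" "g \<in> ideal_on D es"
  shows "(\<lambda>a. f a + g a) \<in> ideal_on D es"
proof -
  obtain h h' where "\<forall>k<length es. poly_fun (h k)" "\<forall>a\<in>D. f a = (\<Sum>k<length es. h k a * (es ! k) a)"
    "\<forall>k<length es. poly_fun (h' k)" "\<forall>a\<in>D. g a = (\<Sum>k<length es. h' k a * (es ! k) a)"
    using assms unfolding ideal_on_def by blast
  thus ?thesis unfolding ideal_on_def
    by (intro CollectI exI[of _ "\<lambda>k a. h k a + h' k a"])
      (simp add: poly_fun.add distrib_right sum.distrib)
qed

lemma ideal_on_mult:
  assumes "poly_fun g" "f \<in> ideal_on D es"
  shows "(\<lambda>a. g a * f a) \<in> ideal_on D es"
proof -
  obtain h where "\<forall>k<length es. poly_fun (h k)" "\<forall>a\<in>D. f a = (\<Sum>k<length es. h k a * (es ! k) a)"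
    using assms unfolding ideal_on_def by blast
  thus ?thesis unfolding ideal_on_def
    by (intro CollectI exI[of _ "\<lambda>k a. g a * h k a"])
      (simp add: poly_fun.mult assms(1) sum_distrib_left mult.assoc)
qed

lemma ideal_on_gen:
  assumes "k < length es"
  shows "es ! k \<in> ideal_on D es"
proof -
  have "(es ! k) a = (\<Sum>i<length es. (if i = k then 1 else 0) * (es ! i) a)" for a
    using assms by (simp add: if_distrib[of "\<lambda>c. c * _"] cong: if_cong)
  thus ?thesis unfolding ideal_on_def
    by (intro CollectI exI[of _ "\<lambda>i a. if i = k then 1 else 0"]) (simp add: poly_fun.const)
qed

lemma ideal_on_cong:
  assumes "f \<in> ideal_on D es" "\<And>a. a \<in> D \<Longrightarrow> g a = f a"
  shows "g \<in> ideal_on D es"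
  using assms by (simp add: ideal_on_def)

lemma poly_fun_subst:
  assumes "poly_fun f" "\<And>i k. poly_fun (\<lambda>a. \<sigma> a i $ k)"
  shows "poly_fun (\<lambda>a. f (\<sigma> a))"
  using assms(1) by induction (auto intro: poly_fun.intros assms(2))

text \<open>Polynomials respect congruence modulo an ideal. For a product the difference splits as
  g(\<sigma>) (f(\<sigma>) - f(\<tau>)) + f(\<tau>) (g(\<sigma>) - g(\<tau>)).\<close>

lemma poly_fun_subst_diff:
  assumes "poly_fun f" and \<sigma>: "\<And>i k. poly_fun (\<lambda>a. \<sigma> a i $ k)" and \<tau>: "\<And>i k. poly_fun (\<lambda>a. \<tau> a i $ k)"
    and diff: "\<And>i k. (\<lambda>a. \<sigma> a i $ k - \<tau> a i $ k) \<in> ideal_on D es"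
  shows "(\<lambda>a. f (\<sigma> a) - f (\<tau> a)) \<in> ideal_on D es"
  using assms(1)
proof induction
  case (const c)
  show ?case by (rule ideal_on_zero) simp
next
  case (coord i k)
  show ?case by (rule diff)
next
  case (add f g)
  from ideal_on_add[OF add.IH] show ?case by (rule ideal_on_cong) simp
next
  case (mult f g)
  from ideal_on_add[OF ideal_on_mult[OF poly_fun_subst[OF mult.hyps(2), of \<sigma>, OF \<sigma>] mult.IH(1)]
      ideal_on_mult[OF poly_fun_subst[OF mult.hyps(1), of \<tau>, OF \<tau>] mult.IH(2)]]
  show ?case by (rule ideal_on_cong) (simp add: algebra_simps)
qed

text \<open>A rational section \<open>r\<close> onto \<open>X\<close>, defined at \<open>b\<close>, that is the identity modulo the equations:
  since \<open>r\<^sub>m a \<equiv> a\<^sub>m r(a)\<close>, homogeneity turns \<open>f(a)\<close> times powers of the \<open>r\<^sub>m\<close> into a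
  multiple of \<open>f(r(a))\<close>, which is \<open>0\<close> wherever \<open>r(a)\<close> is a point. The extra factors \<open>r\<^sub>m\<close> deal with
  the points where it is not.\<close>

lemma local_generation:
  fixes r :: "('i::finite \<Rightarrow> complex^3) \<Rightarrow> 'i \<Rightarrow> complex^3"
  assumes hom: "\<And>j k. \<exists>d. multihom d (\<lambda>a. r a j $ k)"
    and minors: "\<And>j m k. (\<lambda>a. r a j $ m * a j $ k - a j $ m * r a j $ k) \<in> ideal_on D es"
    and onto: "\<And>a. a \<in> D \<Longrightarrow> (\<And>j. r a j \<noteq> 0) \<Longrightarrow> \<exists>Q\<in>X. hcoords (r a) Q"
    and b: "\<And>j. r b j \<noteq> 0"
    and f: "multihom d f" "\<And>Q. Q \<in> X \<Longrightarrow> vanishes_at f Q"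
  shows "\<exists>d' g. multihom d' g \<and> g b \<noteq> 0 \<and> (\<lambda>a. g a * f a) \<in> ideal_on D es"
proof -
  have "\<forall>j. \<exists>m. r b j $ m \<noteq> 0" using b by (auto simp: vec_eq_iff)
  then obtain m where m: "\<And>j. r b j $ m j \<noteq> 0" by metis
  define c where "c a j = r a j $ m j" for a j
  define p where "p a = (\<Prod>j\<in>UNIV. c a j)" for a
  define g where "g a = (\<Prod>j\<in>UNIV. c a j ^ Suc (d j))" for a
  have r: "poly_fun (\<lambda>a. r a j $ k)" for j k using hom[of j k] by (auto simp: multihom_def)
  have fp: "poly_fun f" "\<And>c a. f (\<lambda>i. c i *s a i) = (\<Prod>i\<in>UNIV. c i ^ d i) * f a"
    using f(1) by (simp_all add: multihom_def)
  have "\<exists>d'. multihom d' (\<lambda>a. c a j ^ Suc (d j))" for j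
    using hom[of j "m j"] multihom_power unfolding c_def by blast
  hence g: "\<exists>d'. multihom d' g" unfolding g_def by (rule multihom_prod[OF finite])
  have gb: "g b \<noteq> 0" by (simp add: g_def c_def m)
  have p: "poly_fun p" unfolding p_def c_def by (rule poly_fun_prod[OF finite r])
  have "(\<lambda>a. f (\<lambda>j. c a j *s a j) - f (\<lambda>j. a j $ m j *s r a j)) \<in> ideal_on D es"
  proof (rule poly_fun_subst_diff[OF fp(1)])
    show "poly_fun (\<lambda>a. (c a j *s a j) $ k)" "poly_fun (\<lambda>a. (a j $ m j *s r a j) $ k)" for j k
      by (simp_all add: c_def poly_fun.mult poly_fun.coord r)
    show "(\<lambda>a. (c a j *s a j) $ k - (a j $ m j *s r a j) $ k) \<in> ideal_on D es" for j k
      using minors[of j "m j" k] by (simp add: c_def)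
  qed
  from ideal_on_mult[OF p this] have "(\<lambda>a. g a * f a) \<in> ideal_on D es"
  proof (rule ideal_on_cong)
    fix a assume a: "a \<in> D"
    have "p a * f (r a) = 0"
    proof (cases "p a = 0")
      case False
      hence "c a j \<noteq> 0" for j by (simp add: p_def)
      hence "r a j \<noteq> 0" for j by (metis c_def zero_index)
      then obtain Q where "Q \<in> X" "hcoords (r a) Q" using onto[OF a] by blast
      thus ?thesis using f(2) by (simp add: vanishes_at_def)
    qed simp
    hence "p a * ((\<Prod>i\<in>UNIV. (a i $ m i) ^ d i) * f (r a)) = 0" by auto
    thus "g a * f a = p a * (f (\<lambda>j. c a j *s a j) - f (\<lambda>j. a j $ m j *s r a j))"
      by (simp add: fp(2) g_def p_def prod.distrib algebra_simps)
  qed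
  thus ?thesis using g gb by blast
qed

section \<open>Four charts\<close>

text \<open>A chart keeps two factors and solves for the other three. It fails only where the two kept
  coordinates are certain pairs of the points \<open>(0:1:1)\<close>, \<open>(1:0:-1)\<close>, \<open>(1:1:0)\<close>. Four charts whose pairs
  form a 4-cycle suffice: following the cycle, failure of three of them contradicts failure of the
  fourth.\<close>

definition is_chart :: "((factor \<Rightarrow> complex^3) \<Rightarrow> factor \<Rightarrow> complex^3) \<Rightarrow> bool" where
  "is_chart r \<longleftrightarrow> (\<forall>j k. \<exists>d. multihom d (\<lambda>a. r a j $ k)) \<and>
     (\<forall>a. on_lines a \<longrightarrow> on_lines (r a) \<and> (\<forall>e\<in>set eqns. e (r a) = 0)) \<and>
     (\<forall>j. \<exists>c. \<exists>k<length eqns. \<forall>a. on_lines a \<longrightarrow>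
        r a j $ 1 * a j $ 2 - r a j $ 2 * a j $ 1 = c * (eqns ! k) a)"

text \<open>Each solved factor comes from the one equation it shares with \<open>V\<close> and
  \<open>W\<close>: \<open>Z\<close> from equation 1, \<open>T\<close> from 2, \<open>S\<close> from
  8. Such an equation fixes the ratio of two coordinates; the third follows from the line relation.
  The other charts arise in the same way.\<close>

definition chart_VW :: "(factor \<Rightarrow> complex^3) \<Rightarrow> factor \<Rightarrow> complex^3" where
  "chart_VW a j = (case j of V \<Rightarrow> a V | W \<Rightarrow> a W
     | Z \<Rightarrow> vector [a V $ 2 * a W $ 2, a V $ 1 * a W $ 1, a V $ 1 * a W $ 1 - a V $ 2 * a W $ 2]
     | T \<Rightarrow> vector [a V $ 2 * a W $ 3, a V $ 2 * a W $ 3 + a V $ 3 * a W $ 1, a V $ 3 * a W $ 1]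
     | S \<Rightarrow> vector [a V $ 1 * a W $ 3, a V $ 1 * a W $ 3 + a V $ 3 * a W $ 2, a V $ 3 * a W $ 2])"

definition chart_WZ :: "(factor \<Rightarrow> complex^3) \<Rightarrow> factor \<Rightarrow> complex^3" where
  "chart_WZ a j = (case j of W \<Rightarrow> a W | Z \<Rightarrow> a Z
     | V \<Rightarrow> vector [a W $ 2 * a Z $ 2, a W $ 1 * a Z $ 1, a W $ 1 * a Z $ 1 - a W $ 2 * a Z $ 2]
     | T \<Rightarrow> vector [a W $ 3 * a Z $ 1, - (a W $ 2 * a Z $ 3), - (a W $ 3 * a Z $ 1) - a W $ 2 * a Z $ 3]
     | S \<Rightarrow> vector [a W $ 3 * a Z $ 2, - (a W $ 1 * a Z $ 3), - (a W $ 3 * a Z $ 2) - a W $ 1 * a Z $ 3])"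

definition chart_ZT :: "(factor \<Rightarrow> complex^3) \<Rightarrow> factor \<Rightarrow> complex^3" where
  "chart_ZT a j = (case j of Z \<Rightarrow> a Z | T \<Rightarrow> a T
     | V \<Rightarrow> vector [- (a Z $ 2 * a T $ 2), a Z $ 3 * a T $ 3 - a Z $ 2 * a T $ 2, a Z $ 3 * a T $ 3]
     | W \<Rightarrow> vector [a Z $ 1 * a T $ 2 + a Z $ 3 * a T $ 1, a Z $ 1 * a T $ 2, - (a Z $ 3 * a T $ 1)]
     | S \<Rightarrow> vector [a Z $ 2 * a T $ 1, a Z $ 2 * a T $ 1 + a Z $ 1 * a T $ 3, a Z $ 1 * a T $ 3])"

definition chart_VT :: "(factor \<Rightarrow> complex^3) \<Rightarrow> factor \<Rightarrow> complex^3" where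
  "chart_VT a j = (case j of V \<Rightarrow> a V | T \<Rightarrow> a T
     | W \<Rightarrow> vector [a V $ 2 * a T $ 3, a V $ 2 * a T $ 3 + a V $ 3 * a T $ 1, a V $ 3 * a T $ 1]
     | Z \<Rightarrow> vector [a V $ 1 * a T $ 3 + a V $ 3 * a T $ 2, a V $ 1 * a T $ 3, - (a V $ 3 * a T $ 2)]
     | S \<Rightarrow> vector [a V $ 1 * a T $ 1, a V $ 2 * a T $ 2, a V $ 2 * a T $ 2 - a V $ 1 * a T $ 1])"

lemma multihom_kept: "\<exists>d. multihom d (\<lambda>a. a j $ k)"
  using mh_coord by blast

text \<open>Common shape of all solved factors: combinations of two monomials of degree 1 in each
  kept factor. Its instances only list factors, indices and coefficients.\<close>

lemma multihom_solved:
  "\<exists>d. multihom d (\<lambda>a. vector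
     [\<alpha> * (a i $ p * a j $ q) + \<beta> * (a i $ p' * a j $ q'),
      \<alpha>' * (a i $ p * a j $ q) + \<beta>' * (a i $ p' * a j $ q'),
      \<alpha>'' * (a i $ p * a j $ q) + \<beta>'' * (a i $ p' * a j $ q')] $ (k::3))"
proof -
  have "multihom (\<lambda>l. (if l = i then 1 else 0) + (if l = j then 1 else 0))
     (\<lambda>a. \<alpha> * (a i $ p * a j $ q) + \<beta> * (a i $ p' * a j $ q'))" for \<alpha> \<beta>
    by (intro mh_add mh_cmult mh_mult mh_coord)
  hence "\<exists>d. multihom d (\<lambda>a. \<alpha> * (a i $ p * a j $ q) + \<beta> * (a i $ p' * a j $ q'))" for \<alpha> \<beta>
    by blast
  thus ?thesis using exhaust_3[of k] by (elim disjE) simp_all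
qed

lemma is_chartI:
  assumes "\<And>j k. \<exists>d. multihom d (\<lambda>a. r a j $ k)"
    and "\<And>a. on_lines a \<Longrightarrow> on_lines (r a)"
    and "\<And>a. on_lines a \<Longrightarrow> \<forall>e\<in>set eqns. e (r a) = 0"
    and "\<And>j. \<exists>c. \<exists>k<length eqns. \<forall>a. on_lines a \<longrightarrow>
        r a j $ 1 * a j $ 2 - r a j $ 2 * a j $ 1 = c * (eqns ! k) a"
  shows "is_chart r"
  using assms unfolding is_chart_def by blast

lemma is_chart_VW: "is_chart chart_VW"
proof (rule is_chartI)
  show "\<exists>d. multihom d (\<lambda>a. chart_VW a j $ k)" for j k
    using multihom_kept[of j k]
      multihom_solved[of 0 V 1 W 1 1 2 2 1 0 1 "-1" k]
      multihom_solved[of 1 V 2 W 3 0 3 1 1 1 0 1 k]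
      multihom_solved[of 1 V 1 W 3 0 3 2 1 1 0 1 k]
    by (cases j) (simp_all add: chart_VW_def)
  fix a :: "factor \<Rightarrow> complex^3" assume "on_lines a"
  hence third: "a j $ 3 = a j $ 2 - a j $ 1" for j by (simp add: on_lines_def)
  have "chart_VW a j $ 3 = chart_VW a j $ 2 - chart_VW a j $ 1" for j
    by (cases j) (simp_all add: chart_VW_def third)
  thus "on_lines (chart_VW a)" by (simp add: on_lines_def)
  show "\<forall>e\<in>set eqns. e (chart_VW a) = 0"
    by (simp add: eqns_def chart_VW_def third algebra_simps)
next
  fix j
  \<comment> \<open>A kept factor is unchanged, so its constant is 0 and its position in
    \<open>eqns\<close> is arbitrary. Positions count from 0: 0, 1 and 7 stand for equations 1, 2
    and 8.\<close>
  show "\<exists>c. \<exists>k<length eqns. \<forall>a. on_lines a \<longrightarrow>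
      chart_VW a j $ 1 * a j $ 2 - chart_VW a j $ 2 * a j $ 1 = c * (eqns ! k) a"
    by (rule exI[of _ "case j of V \<Rightarrow> 0 | W \<Rightarrow> 0 | _ \<Rightarrow> - 1"],
        rule exI[of _ "case j of Z \<Rightarrow> 0 | T \<Rightarrow> 1 | _ \<Rightarrow> 7"])
      (cases j; simp add: eqns_def chart_VW_def on_lines_third algebra_simps)
qed

lemma is_chart_WZ: "is_chart chart_WZ"
proof (rule is_chartI)
  show "\<exists>d. multihom d (\<lambda>a. chart_WZ a j $ k)" for j k
    using multihom_kept[of j k]
      multihom_solved[of 0 W 1 Z 1 1 2 2 1 0 1 "-1" k]
      multihom_solved[of 1 W 3 Z 1 0 2 3 0 "-1" "-1" "-1" k]
      multihom_solved[of 1 W 3 Z 2 0 1 3 0 "-1" "-1" "-1" k]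
    by (cases j) (simp_all add: chart_WZ_def)
  fix a :: "factor \<Rightarrow> complex^3" assume "on_lines a"
  hence third: "a j $ 3 = a j $ 2 - a j $ 1" for j by (rule on_lines_third)
  have "chart_WZ a j $ 3 = chart_WZ a j $ 2 - chart_WZ a j $ 1" for j
    by (cases j) (simp_all add: chart_WZ_def third)
  thus "on_lines (chart_WZ a)" by (simp add: on_lines_def)
  show "\<forall>e\<in>set eqns. e (chart_WZ a) = 0"
    by (simp add: eqns_def chart_WZ_def third algebra_simps)
next
  fix j
  show "\<exists>c. \<exists>k<length eqns. \<forall>a. on_lines a \<longrightarrow>
      chart_WZ a j $ 1 * a j $ 2 - chart_WZ a j $ 2 * a j $ 1 = c * (eqns ! k) a"
    by (rule exI[of _ "case j of V \<Rightarrow> - 1 | T \<Rightarrow> 1 | S \<Rightarrow> 1 | _ \<Rightarrow> 0"],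
        rule exI[of _ "case j of V \<Rightarrow> 0 | T \<Rightarrow> 3 | _ \<Rightarrow> 9"])
      (cases j; simp add: eqns_def chart_WZ_def on_lines_third algebra_simps)
qed

lemma is_chart_ZT: "is_chart chart_ZT"
proof (rule is_chartI)
  show "\<exists>d. multihom d (\<lambda>a. chart_ZT a j $ k)" for j k
    using multihom_kept[of j k]
      multihom_solved[of 0 Z 3 T 3 "-1" 2 2 1 "-1" 1 0 k]
      multihom_solved[of 1 Z 1 T 2 1 3 1 1 0 0 "-1" k]
      multihom_solved[of 1 Z 2 T 1 0 1 3 1 1 0 1 k]
    by (cases j) (simp_all add: chart_ZT_def)
  fix a :: "factor \<Rightarrow> complex^3" assume "on_lines a"
  hence third: "a j $ 3 = a j $ 2 - a j $ 1" for j by (rule on_lines_third)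
  have "chart_ZT a j $ 3 = chart_ZT a j $ 2 - chart_ZT a j $ 1" for j
    by (cases j) (simp_all add: chart_ZT_def third)
  thus "on_lines (chart_ZT a)" by (simp add: on_lines_def)
  show "\<forall>e\<in>set eqns. e (chart_ZT a) = 0"
    by (simp add: eqns_def chart_ZT_def third algebra_simps)
next
  fix j
  show "\<exists>c. \<exists>k<length eqns. \<forall>a. on_lines a \<longrightarrow>
      chart_ZT a j $ 1 * a j $ 2 - chart_ZT a j $ 2 * a j $ 1 = c * (eqns ! k) a"
    by (rule exI[of _ "case j of V \<Rightarrow> - 1 | W \<Rightarrow> 1 | S \<Rightarrow> 1 | _ \<Rightarrow> 0"],
        rule exI[of _ "case j of V \<Rightarrow> 2 | W \<Rightarrow> 3 | _ \<Rightarrow> 5"])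
      (cases j; simp add: eqns_def chart_ZT_def on_lines_third algebra_simps)
qed

lemma is_chart_VT: "is_chart chart_VT"
proof (rule is_chartI)
  show "\<exists>d. multihom d (\<lambda>a. chart_VT a j $ k)" for j k
    using multihom_kept[of j k]
      multihom_solved[of 1 V 2 T 3 0 3 1 1 1 0 1 k]
      multihom_solved[of 1 V 1 T 3 1 3 2 1 0 0 "-1" k]
      multihom_solved[of 1 V 1 T 1 0 2 2 0 1 "-1" 1 k]
    by (cases j) (simp_all add: chart_VT_def)
  fix a :: "factor \<Rightarrow> complex^3" assume "on_lines a"
  hence third: "a j $ 3 = a j $ 2 - a j $ 1" for j by (rule on_lines_third)
  have "chart_VT a j $ 3 = chart_VT a j $ 2 - chart_VT a j $ 1" for j
    by (cases j) (simp_all add: chart_VT_def third)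
  thus "on_lines (chart_VT a)" by (simp add: on_lines_def)
  show "\<forall>e\<in>set eqns. e (chart_VT a) = 0"
    by (simp add: eqns_def chart_VT_def third algebra_simps)
next
  fix j
  show "\<exists>c. \<exists>k<length eqns. \<forall>a. on_lines a \<longrightarrow>
      chart_VT a j $ 1 * a j $ 2 - chart_VT a j $ 2 * a j $ 1 = c * (eqns ! k) a"
    by (rule exI[of _ "case j of W \<Rightarrow> - 1 | Z \<Rightarrow> 1 | S \<Rightarrow> 1 | _ \<Rightarrow> 0"],
        rule exI[of _ "case j of W \<Rightarrow> 1 | Z \<Rightarrow> 2 | _ \<Rightarrow> 4"])
      (cases j; simp add: eqns_def chart_VT_def on_lines_third algebra_simps)
qed

text \<open>Each solved factor vanishes at two of the three bad pairs of its chart, whence the four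
  disjunctions. They match the special points of neighbouring factors; composing the matchings once
  around the cycle \<open>V\<close>, \<open>W\<close>, \<open>Z\<close>, \<open>T\<close> gives a
  3-cycle, which has no fixed point. A triangle on \<open>V\<close>, \<open>W\<close>,
  \<open>Z\<close> would not do: its charts all fail at v = w = z = (1:1:0).\<close>

lemma chart_cover:
  assumes "on_lines a" "\<And>j. a j \<noteq> 0"
  shows "\<exists>r. is_chart r \<and> (\<forall>j. r a j \<noteq> 0)"
proof (rule ccontr)
  assume "\<not> ?thesis"
  hence bad: "\<exists>j. chart_VW a j = 0" "\<exists>j. chart_WZ a j = 0" "\<exists>j. chart_ZT a j = 0" "\<exists>j. chart_VT a j = 0"
    using is_chart_VW is_chart_WZ is_chart_ZT is_chart_VT by blast+
  have third: "a j $ 3 = a j $ 2 - a j $ 1" for j using on_lines_third[OF assms(1)] .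
  define v1 v2 w1 w2 z1 z2 t1 t2 where "v1 = a V $ 1" "v2 = a V $ 2" "w1 = a W $ 1" "w2 = a W $ 2"
    "z1 = a Z $ 1" "z2 = a Z $ 2" "t1 = a T $ 1" "t2 = a T $ 2"
  note d = this[symmetric]
  have nz: "v1 \<noteq> 0 \<or> v2 \<noteq> 0" "w1 \<noteq> 0 \<or> w2 \<noteq> 0" "z1 \<noteq> 0 \<or> z2 \<noteq> 0" "t1 \<noteq> 0 \<or> t2 \<noteq> 0"
    using assms(2)[of V] assms(2)[of W] assms(2)[of Z] assms(2)[of T] unfolding nz3 third d by auto
  have "v1 = 0 \<and> w2 = 0 \<or> v2 = 0 \<and> w1 = 0 \<or> v1 = v2 \<and> w1 = w2"
    using bad(1) nz assms(2) by (elim exE, case_tac j) (auto simp: chart_VW_def third d)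
  moreover have "w1 = 0 \<and> z2 = 0 \<or> w2 = 0 \<and> z1 = 0 \<or> w1 = w2 \<and> z1 = z2"
    using bad(2) nz assms(2) by (elim exE, case_tac j) (auto simp: chart_WZ_def third d)
  moreover have "z1 = z2 \<and> t2 = 0 \<or> z2 = 0 \<and> t1 = t2 \<or> z1 = 0 \<and> t1 = 0"
    using bad(3) nz assms(2) by (elim exE, case_tac j) (auto simp: chart_ZT_def third d)
  moreover have "v1 = v2 \<and> t1 = t2 \<or> v2 = 0 \<and> t1 = 0 \<or> v1 = 0 \<and> t2 = 0"
    using bad(4) nz assms(2) by (elim exE, case_tac j) (auto simp: chart_VT_def third d)
  ultimately show False using nz by auto
qed

section \<open>From charts to generation of the ideal sheaf\<close>

lemma defined_in_by_eqns: "defined_in_by Lambda_prod eqns (fib_phi ` del_pezzo)"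
  unfolding defined_in_by_def
proof (intro conjI ballI allI impI)
  show "fib_phi ` del_pezzo = {P \<in> Lambda_prod. \<forall>e\<in>set eqns. vanishes_at e P}" by (rule fib_phi_image)
next
  fix P d f assume P: "P \<in> Lambda_prod" and f: "multihom d f \<and> (\<forall>Q\<in>fib_phi ` del_pezzo. vanishes_at f Q)"
  obtain b where b: "hcoords b P" using hcoords_ex by blast
  define D where "D = {a. \<exists>Q\<in>Lambda_prod. hcoords a Q}"
  have D: "on_lines a" if "a \<in> D" for a using that Lambda_prod_iff by (auto simp: D_def)
  have "\<exists>d' g. multihom d' g \<and> g b \<noteq> 0 \<and> (\<lambda>a. g a * f a) \<in> ideal_on D eqns"
  proof (cases "P \<in> fib_phi ` del_pezzo")
    \<comment> \<open>Off the image some equation is nonzero at \<open>P\<close>; taken as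
      \<open>g\<close>, it makes the product with \<open>f\<close> a multiple of a
      generator.\<close>
    case False
    then obtain k where k: "k < length eqns" "\<not> vanishes_at (eqns ! k) P"
      unfolding fib_phi_image using P by (auto simp: in_set_conv_nth)
    obtain d' where d': "multihom d' (eqns ! k)" using multihom_eqns k(1) nth_mem by blast
    have "(\<lambda>a. f a * (eqns ! k) a) \<in> ideal_on D eqns"
      using f by (intro ideal_on_mult ideal_on_gen k(1)) (simp add: multihom_def)
    hence "(\<lambda>a. (eqns ! k) a * f a) \<in> ideal_on D eqns" by (simp add: mult.commute)
    thus ?thesis using d' k(2) vanishes_at_iff[OF d' b] by blast
  next
    case True
    have "on_lines b" "\<And>j. b j \<noteq> 0" using Lambda_prod_iff[OF b] P b by (simp_all add: hcoords_def)
    from chart_cover[OF this] obtain r where r: "is_chart r" "\<And>j. r b j \<noteq> 0" by blast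
    have minor: "(\<lambda>a. r a j $ m * a j $ k - a j $ m * r a j $ k) \<in> ideal_on D eqns" for j m k
    proof -
      define \<delta> where "\<delta> a = r a j $ 1 * a j $ 2 - r a j $ 2 * a j $ 1" for a
      obtain c l where l: "l < length eqns" "\<And>a. on_lines a \<Longrightarrow> \<delta> a = c * (eqns ! l) a"
        using r(1) unfolding is_chart_def \<delta>_def by blast
      have \<delta>: "(\<lambda>a. e * \<delta> a) \<in> ideal_on D eqns" for e
        using ideal_on_mult[OF poly_fun.const ideal_on_gen[OF l(1)], of "e * c"]
        by (rule ideal_on_cong) (simp add: l(2) D)
      have "\<exists>e. \<forall>a\<in>D. r a j $ m * a j $ k - a j $ m * r a j $ k = e * \<delta> a"
      proof -
        have third: "a j $ 3 = a j $ 2 - a j $ 1" "r a j $ 3 = r a j $ 2 - r a j $ 1" if "a \<in> D" for a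
          using D[OF that] r(1) by (auto simp: is_chart_def intro: on_lines_third)
        \<comment> \<open>Two vectors satisfying the same line relation have equal minors for the
          index pairs (1,2), (1,3) and (2,3); \<epsilon> records the sign under exchange and 0 on
          the diagonal.\<close>
        define \<epsilon> :: "3 \<Rightarrow> 3 \<Rightarrow> complex" where
          "\<epsilon> m k = (if m = k then 0 else if m = 1 \<or> m = 2 \<and> k = 3 then 1 else - 1)" for m k
        have "r a j $ m * a j $ k - a j $ m * r a j $ k = \<epsilon> m k * \<delta> a" if "a \<in> D" for a
          using exhaust_3[of m] exhaust_3[of k]
          by (elim disjE) (simp_all add: third[OF that] \<epsilon>_def \<delta>_def algebra_simps)
        thus ?thesis by blast
      qed
      then obtain e where e: "\<forall>a\<in>D. r a j $ m * a j $ k - a j $ m * r a j $ k = e * \<delta> a" by blast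
      show ?thesis by (rule ideal_on_cong[OF \<delta>[of e]]) (use e in simp)
    qed
    show ?thesis
    proof (rule local_generation[where r = r and X = "fib_phi ` del_pezzo" and d = d])
      show "\<exists>d. multihom d (\<lambda>a. r a j $ k)" for j k using r(1) by (simp add: is_chart_def)
      show "\<exists>Q\<in>fib_phi ` del_pezzo. hcoords (r a) Q" if "a \<in> D" "\<And>j. r a j \<noteq> 0" for a
      proof
        show h: "hcoords (r a) (\<lambda>j. hc (r a j))" using that by (simp add: hcoords_def)
        have "on_lines (r a)" "\<forall>e\<in>set eqns. e (r a) = 0"
          using r(1) D[OF that(1)] by (simp_all add: is_chart_def)
        moreover have "vanishes_at e (\<lambda>j. hc (r a j))" if "e \<in> set eqns" "e (r a) = 0" for e
          using vanishes_at_iff[OF _ h] multihom_eqns[OF that(1)] that(2) by blast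
        ultimately show "(\<lambda>j. hc (r a j)) \<in> fib_phi ` del_pezzo"
          unfolding fib_phi_image using Lambda_prod_iff[OF h] by simp
      qed
    qed (use r(2) f minor in auto)
  qed
  then obtain d' g h where "multihom d' g" "g b \<noteq> 0" "\<forall>k<length eqns. poly_fun (h k)"
      "\<forall>a\<in>D. g a * f a = (\<Sum>k<length eqns. h k a * (eqns ! k) a)"
    unfolding ideal_on_def by blast
  moreover have "\<not> vanishes_at g P" using \<open>g b \<noteq> 0\<close> b by (auto simp: vanishes_at_def)
  ultimately show "\<exists>d' g h. multihom d' g \<and> \<not> vanishes_at g P \<and> (\<forall>k<length eqns. poly_fun (h k)) \<and>
      (\<forall>Q\<in>Lambda_prod. \<forall>a. hcoords a Q \<longrightarrow> g a * f a = (\<Sum>k<length eqns. h k a * (eqns ! k) a))"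
    unfolding D_def by blast
qed

theorem theorem5p3:
  fixes \<Phi> :: "(bl \<Rightarrow> p2) \<Rightarrow> (factor \<Rightarrow> p2)"
  assumes "is_phi_morphism \<Phi>"
  shows "defined_in_by Lambda_prod
    [\<lambda>a. a V $ 1 * a W $ 1 * a Z $ 1 - a V $ 2 * a W $ 2 * a Z $ 2,
     \<lambda>a. a V $ 3 * a W $ 1 * a T $ 1 - a V $ 2 * a W $ 3 * a T $ 3,
     \<lambda>a. a V $ 1 * a Z $ 3 * a T $ 3 + a V $ 3 * a Z $ 2 * a T $ 2,
     \<lambda>a. a W $ 3 * a Z $ 1 * a T $ 2 + a W $ 2 * a Z $ 3 * a T $ 1,
     \<lambda>a. a T $ 1 * a V $ 1 * a S $ 2 - a T $ 2 * a V $ 2 * a S $ 1,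
     \<lambda>a. a T $ 1 * a Z $ 2 * a S $ 3 - a T $ 3 * a Z $ 1 * a S $ 1,
     \<lambda>a. a T $ 3 * a W $ 2 * a S $ 2 - a T $ 2 * a W $ 1 * a S $ 3,
     \<lambda>a. a V $ 3 * a W $ 2 * a S $ 1 - a V $ 1 * a W $ 3 * a S $ 3,
     \<lambda>a. a V $ 2 * a Z $ 3 * a S $ 3 + a V $ 3 * a Z $ 1 * a S $ 2,
     \<lambda>a. a W $ 3 * a Z $ 2 * a S $ 2 + a W $ 1 * a Z $ 3 * a S $ 1]
    (\<Phi> ` del_pezzo)"
proof -
  have "\<Phi> ` del_pezzo = fib_phi ` del_pezzo"
    using phi_morphism_unique[OF assms] by (rule image_cong[OF refl])
  thus ?thesis using defined_in_by_eqns unfolding eqns_def by simp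
qed

end
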